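(* The extremal rays of the five-dimensional closed convex cone $\mathcal{P}^{s+}_{3,5}$ are exactly the rays $\mathbb{R}_{\ge0}f$ where $f$ is one of the following polynomials: (i) $\mathfrak{e}^A_{t,u}$ with $0\le t\le 7$ and $0\le u\le \mu_A(t)$; (ii) $\mathfrak{e}^B_{t,u}$ with $2\le t<\infty$ and $\mu_B(t)\le u\le 1$; (iii) $\mathfrak{e}^C_t$ with $0\le t\le 2$; (iv) $\mathfrak{e}^D_t$ with $t\in[0,\infty]$; (v) $\mathfrak{e}^E_t$ with $t\in[7,\infty]$; (vi) $U(S_2-S_{1,1})=s_3$. That is, each listed polynomial is an extremal element of $\mathcal{P}^{s+}_{3,5}$, and every extremal element of $\mathcal{P}^{s+}_{3,5}$ is a positive multiple of one of them.
   Context: Let $a,b,c$ be variables. For nonnegative integers $m,n$ put $S_{m,n}=a^mb^n+b^mc^n+c^ma^n$, $S_n=S_{n,0}=a^n+b^n+c^n$, $T_{m,n}=S_{m,n}+S_{n,m}$, $U=abc$ (so $S_{1,1}=ab+bc+ca$). Let $\mathcal{H}^s_{3,5}$ be the real vector space of symmetric homogeneous polynomials of degree 5 in $\mathbb{R}[a,b,c]$; it has basis $s_0=S_5-US_{1,1}$, $s_1=T_{4,1}-2US_{1,1}$, $s_2=T_{3,2}-2US_{1,1}$, $s_3=US_2-US_{1,1}$, $s_4=US_{1,1}$. Let $\mathcal{P}^{s+}_{3,5}=\{f\in\mathcal{H}^s_{3,5}: f(a,b,c)\ge 0\text{ for all }a,b,c\ge0\}$. For a closed convex cone $\mathcal{P}$,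 an element $f\in\mathcal{P}\setminus\{0\}$ is extremal if whenever $f=g+h$ with $g,h\in\mathcal{P}$ we have $g,h\in\mathbb{R}_{\ge0}f$; $\mathbb{R}_{\ge0}f$ is then an extremal ray. Auxiliary functions: $\mu_L(t)=9(t-1)^2$, $\mu_H(t)=(t+2)(7-t)$, $\mu_A(t)=\min\{\mu_L(t),\mu_H(t)\}$, $\mu_R(t)=2-t^2+t\sqrt{(t-1)(t+2)}$, $\mu_B(t)=\tfrac12\big(\mu_R(t)-\sqrt{\mu_R(t)^2-4}\big)$ (for $t\ge2$), $\mu_Z(t,u)=\frac{(t+2)(7-t)-u}{(t+2)(5t+1)}$, $\omega(u)=u+\frac1u-2$. Family A: for $u>0$, $\mathfrak{e}^A_{t,u}=s_0+\sum_{i=1}^4p^A_i(t,u)s_i$ where $p^A_1=\dfrac{u^2-(t+2)(5t^2+t+9)u+9(t-1)^2(t+2)^2}{(5t+1)(t+2)u}$, $p^A_2=\dfrac{-t^2u^3+(t-1)(7t^3-t^2+11t+1)u^2+(t+2)(17t^5-25t^4+199t^3-59t^2+76t+8)u+9(t-1)^4(t+2)^2(t^2-12t-1)}{(5t+1)^3(t+2)u}$, $p^A_3=\dfrac{(2t^3+4t^2+5t+1)u^3-2(t+2)(7t^4+42t^3+37t^2+48t+10)u^2+(t+2)^2(91t^5+125t^4+682t^3+182t^2+523t+125)u-18(t-1)^2(t+2)^3(t^4+36t^3+34t^2+60t+13)}{(t+2)^2(5t+1)^3u}$, $p^A_4=\dfrac{(t-1)^3(6t^2+6t-12+u)^3}{(t+2)^2(5t+1)^3u}$;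 and $\mathfrak{e}^A_{t,0}=(5t+1)^2s_1+(t-1)^2(t^2-12t-1)s_2-2(t^4+36t^3+34t^2+60t+13)s_3+24(t-1)^4s_4$. Family B: with $p^B_1(t,w)=-2w-3$, $p^B_2(t,w)=w^2+2w+2$, $p^B_3(t,w)=-\frac{2t^3+4t^2+5t+1}{t^2(t+2)}w^2+\frac{2(4t^2+5t+3)}{t+2}w-\frac{3t^3-7t^2-12t-8}{t+2}$, $p^B_4(t,w)=\frac{(t-1)^3(-w^2-2t^2w+t^2(t-2))}{t^2(t+2)}$, put $\mathfrak{e}^B_{t,u}=s_0+\sum_{i=1}^4p^B_i(t,\omega(u))s_i$. Family C: $\mathfrak{e}^C_t=s_0-(t+1)s_1+ts_2+(t+1)^2s_3$. Family D: $\mathfrak{e}^D_t=s_1+(t^2-1)s_2-2(t+1)^2s_3$, and $\mathfrak{e}^D_\infty=s_2-2s_3$. Family E: $\mathfrak{e}^E_t=s_1-s_2-\frac{4t^2+5t+3}{t+2}s_3+\frac{(t-1)^3}{t+2}s_4$, and $\mathfrak{e}^E_\infty=s_4$. *)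

theory Defs
  imports Complex_Main
begin

text \<open>Ternary forms are represented as real functions of three real variables
(a polynomial over R is determined by its values).\<close>

type_synonym form3 = "real \<Rightarrow> real \<Rightarrow> real \<Rightarrow> real"

definition Smn :: "nat \<Rightarrow> nat \<Rightarrow> form3" where
  "Smn m n = (\<lambda>a b c. a^m * b^n + b^m * c^n + c^m * a^n)"

definition Sn :: "nat \<Rightarrow> form3" where
  "Sn n = Smn n 0"

definition Tmn :: "nat \<Rightarrow> nat \<Rightarrow> form3" where
  "Tmn m n = (\<lambda>a b c. Smn m n a b c + Smn n m a b c)"

definition Uf :: form3 where
  "Uf = (\<lambda>a b c. a * b * c)"

definition s0 :: form3 where "s0 = (\<lambda>a b c. Sn 5 a b c - Uf a b c * Smn 1 1 a b c)"
definition s1 :: form3 where "s1 = (\<lambda>a b c. Tmn 4 1 a b c - 2 * Uf a b c * Smn 1 1 a b c)"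
definition s2 :: form3 where "s2 = (\<lambda>a b c. Tmn 3 2 a b c - 2 * Uf a b c * Smn 1 1 a b c)"
definition s3 :: form3 where "s3 = (\<lambda>a b c. Uf a b c * Sn 2 a b c - Uf a b c * Smn 1 1 a b c)"
definition s4 :: form3 where "s4 = (\<lambda>a b c. Uf a b c * Smn 1 1 a b c)"

definition comb :: "real \<Rightarrow> real \<Rightarrow> real \<Rightarrow> real \<Rightarrow> real \<Rightarrow> form3" where
  "comb c0 c1 c2 c3 c4 = (\<lambda>a b c. c0 * s0 a b c + c1 * s1 a b c + c2 * s2 a b c
      + c3 * s3 a b c + c4 * s4 a b c)"

text \<open>The space H^s_{3,5} of symmetric quintic forms (span of the basis).\<close>
definition Hs35 :: "form3 set" where
  "Hs35 = {f. \<exists>c0 c1 c2 c3 c4. f = comb c0 c1 c2 c3 c4}"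

definition Ps35 :: "form3 set" where
  "Ps35 = {f \<in> Hs35. \<forall>a b c. a \<ge> 0 \<longrightarrow> b \<ge> 0 \<longrightarrow> c \<ge> 0 \<longrightarrow> f a b c \<ge> 0}"

definition addf :: "form3 \<Rightarrow> form3 \<Rightarrow> form3" where
  "addf g h = (\<lambda>a b c. g a b c + h a b c)"

definition scalef :: "real \<Rightarrow> form3 \<Rightarrow> form3" where
  "scalef r f = (\<lambda>a b c. r * f a b c)"

definition extremal :: "form3 set \<Rightarrow> form3 \<Rightarrow> bool" where
  "extremal P f \<longleftrightarrow> f \<in> P \<and> f \<noteq> (\<lambda>a b c. 0) \<and>
     (\<forall>g h. g \<in> P \<longrightarrow> h \<in> P \<longrightarrow> f = addf g h \<longrightarrow>
        (\<exists>r\<ge>0. g = scalef r f) \<and> (\<exists>r\<ge>0. h = scalef r f))"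

definition muL :: "real \<Rightarrow> real" where "muL t = 9 * (t - 1)^2"
definition muH :: "real \<Rightarrow> real" where "muH t = (t + 2) * (7 - t)"
definition muA :: "real \<Rightarrow> real" where "muA t = min (muL t) (muH t)"
definition muR :: "real \<Rightarrow> real" where
  "muR t = 2 - t^2 + t * sqrt ((t - 1) * (t + 2))"
definition muB :: "real \<Rightarrow> real" where
  "muB t = (muR t - sqrt ((muR t)^2 - 4)) / 2"
definition omega :: "real \<Rightarrow> real" where "omega u = u + 1 / u - 2"

definition pA1 :: "real \<Rightarrow> real \<Rightarrow> real" where
  "pA1 t u = (u^2 - (t+2)*(5*t^2+t+9)*u + 9*(t-1)^2*(t+2)^2) / ((5*t+1)*(t+2)*u)"
definition pA2 :: "real \<Rightarrow> real \<Rightarrow> real" where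
  "pA2 t u = (- (t^2) * u^3 + (t-1)*(7*t^3 - t^2 + 11*t + 1)*u^2
      + (t+2)*(17*t^5 - 25*t^4 + 199*t^3 - 59*t^2 + 76*t + 8)*u
      + 9*(t-1)^4*(t+2)^2*(t^2 - 12*t - 1)) / ((5*t+1)^3*(t+2)*u)"
definition pA3 :: "real \<Rightarrow> real \<Rightarrow> real" where
  "pA3 t u = ((2*t^3 + 4*t^2 + 5*t + 1)*u^3
      - 2*(t+2)*(7*t^4 + 42*t^3 + 37*t^2 + 48*t + 10)*u^2
      + (t+2)^2*(91*t^5 + 125*t^4 + 682*t^3 + 182*t^2 + 523*t + 125)*u
      - 18*(t-1)^2*(t+2)^3*(t^4 + 36*t^3 + 34*t^2 + 60*t + 13)) / ((t+2)^2*(5*t+1)^3*u)"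
definition pA4 :: "real \<Rightarrow> real \<Rightarrow> real" where
  "pA4 t u = ((t-1)^3 * (6*t^2 + 6*t - 12 + u)^3) / ((t+2)^2*(5*t+1)^3*u)"

definition eA :: "real \<Rightarrow> real \<Rightarrow> form3" where
  "eA t u = (if u = 0 then
      comb 0 ((5*t+1)^2) ((t-1)^2*(t^2 - 12*t - 1))
        (- 2*(t^4 + 36*t^3 + 34*t^2 + 60*t + 13)) (24*(t-1)^4)
    else comb 1 (pA1 t u) (pA2 t u) (pA3 t u) (pA4 t u))"

definition pB1 :: "real \<Rightarrow> real \<Rightarrow> real" where "pB1 t w = - 2*w - 3"
definition pB2 :: "real \<Rightarrow> real \<Rightarrow> real" where "pB2 t w = w^2 + 2*w + 2"
definition pB3 :: "real \<Rightarrow> real \<Rightarrow> real" where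
  "pB3 t w = - ((2*t^3 + 4*t^2 + 5*t + 1) / (t^2*(t+2))) * w^2
      + (2*(4*t^2 + 5*t + 3) / (t+2)) * w - (3*t^3 - 7*t^2 - 12*t - 8) / (t+2)"
definition pB4 :: "real \<Rightarrow> real \<Rightarrow> real" where
  "pB4 t w = ((t-1)^3 * (- (w^2) - 2*t^2*w + t^2*(t-2))) / (t^2*(t+2))"
definition eB :: "real \<Rightarrow> real \<Rightarrow> form3" where
  "eB t u = comb 1 (pB1 t (omega u)) (pB2 t (omega u)) (pB3 t (omega u)) (pB4 t (omega u))"

definition eC :: "real \<Rightarrow> form3" where
  "eC t = comb 1 (-(t+1)) t ((t+1)^2) 0"
definition eD :: "real \<Rightarrow> form3" where
  "eD t = comb 0 1 (t^2 - 1) (- 2*(t+1)^2) 0"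
definition eD_inf :: form3 where
  "eD_inf = comb 0 0 1 (-2) 0"
definition eE :: "real \<Rightarrow> form3" where
  "eE t = comb 0 1 (-1) (- (4*t^2 + 5*t + 3) / (t+2)) ((t-1)^3 / (t+2))"
definition eE_inf :: form3 where
  "eE_inf = comb 0 0 0 0 1"

definition listed :: "form3 set" where
  "listed =
     {eA t u | t u. 0 \<le> t \<and> t \<le> 7 \<and> 0 \<le> u \<and> u \<le> muA t}
   \<union> {eB t u | t u. 2 \<le> t \<and> muB t \<le> u \<and> u \<le> 1}
   \<union> {eC t | t. 0 \<le> t \<and> t \<le> 2}
   \<union> {eD t | t. 0 \<le> t} \<union> {eD_inf}
   \<union> {eE t | t. 7 \<le> t} \<union> {eE_inf}
   \<union> {s3}"

end

theory Submission
  imports Defs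
begin

text \<open>
  Let \<open>f\<close> be a symmetric quintic form. For fixed \<open>a+b+c\<close> and \<open>ab+bc+ca\<close> it is affine in \<open>abc\<close>, so
  \<open>f \<ge> 0\<close> on the orthant iff \<open>F(x) = f(x,1,1) \<ge> 0\<close> for \<open>x \<ge> 0\<close> and \<open>f(x,1,0) \<ge> 0\<close> for \<open>x \<ge> 0\<close>; the
  latter says that a quadratic \<open>Q(w)\<close> in \<open>w = x + 1/x - 2\<close> is nonnegative for \<open>w \<ge> 0\<close>. The quintics \<open>F\<close>
  that occur are those with \<open>3F'(1) = 5F(1)\<close>, and \<open>Q\<close> is determined by the coefficients of \<open>F\<close>.

  A summand of \<open>f\<close> inherits the double zeros of \<open>F\<close> and \<open>Q\<close>, and for each listed form these zeros
  determine the form up to a factor. Conversely, let \<open>f\<close> be extremal. Subtracting small multiples of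
  \<open>s4\<close> is impossible, so \<open>F = (x-t)\<^sup>2 G\<close> with \<open>t \<ge> 0\<close>, unless \<open>f\<close> is on one of the rays at infinity.
  If \<open>t \<noteq> 1\<close>, perturbing \<open>f\<close> in the direction \<open>eE t\<close> shows that \<open>G\<close> has a double zero (family A), or
  \<open>Q\<close> is a square (family B), or \<open>f\<close> belongs to family E. If \<open>t = 1\<close>, the same argument with \<open>s3\<close> and
  \<open>eD s\<close> leads to families B, C and D.
\<close>

subsection \<open>The cone in terms of two univariate polynomials\<close>

text \<open>Behind the families is a dimension count. The forms span five dimensions, so four linear
  conditions cut out a ray. A double zero of F at a point other than 1, or a double zero of Q, gives
  two conditions; F(0) = 0 or c0 = 0 gives one. At 1 a double zero costs only one condition, because
  F(1) = 3 c4 and F'(1) = 5 c4, and this is why c4 = 0 is a case of its own. For generic parameters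
  A has two double zeros of F, and B one of F and one of Q. C, D and E have one double zero of F at
  t and two of the three conditions F(0) = 0, c4 = 0, c0 = 0. Nonnegativity on x \<ge> 0 allows F or
  its cofactor G a simple zero at 0, so a strict lower bound can only have the shape e(x + x^2), and
  a direction of perturbation has to vanish at 0 as well. The forms s4, s3 and \<open>eE t\<close>
  do. Moreover \<open>eE t\<close> keeps the double zero at t and has Q(w) = w, so it can be added
  and subtracted as soon as Q dominates a positive multiple of w.\<close>

definition Fp :: "real \<Rightarrow> real \<Rightarrow> real \<Rightarrow> real \<Rightarrow> real \<Rightarrow> real \<Rightarrow> real" where
  "Fp c0 c1 c2 c3 c4 x =
     (x - 1)^2 * (c0 * (x^3 + 2*x^2 + 3*x + 2) + 2*c1*(x+1)^2 + 2*c2*(x+1) + c3*x) + c4*x*(2*x+1)"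

definition Fp' :: "real \<Rightarrow> real \<Rightarrow> real \<Rightarrow> real \<Rightarrow> real \<Rightarrow> real \<Rightarrow> real" where
  "Fp' c0 c1 c2 c3 c4 x =
     2*(x - 1) * (c0 * (x^3 + 2*x^2 + 3*x + 2) + 2*c1*(x+1)^2 + 2*c2*(x+1) + c3*x)
     + (x - 1)^2 * (c0 * (3*x^2 + 4*x + 3) + 4*c1*(x+1) + 2*c2 + c3) + c4*(4*x+1)"

text \<open>The forms s3 and s4 are divisible by abc, so a face of the orthant sees only c0, c1, c2.
  There w stands for (x-y)^2/(xy).\<close>

definition Qp :: "real \<Rightarrow> real \<Rightarrow> real \<Rightarrow> real \<Rightarrow> real" where
  "Qp c0 c1 c2 w = c0*w^2 + (3*c0+c1)*w + (c0+c1+c2)"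

definition nonneg_coeffs :: "real \<Rightarrow> real \<Rightarrow> real \<Rightarrow> real \<Rightarrow> real \<Rightarrow> bool" where
  "nonneg_coeffs c0 c1 c2 c3 c4 \<longleftrightarrow>
     (\<forall>x\<ge>0. Fp c0 c1 c2 c3 c4 x \<ge> 0) \<and> (\<forall>w\<ge>0. Qp c0 c1 c2 w \<ge> 0)"

lemma DERIV_Fp: "(Fp c0 c1 c2 c3 c4 has_real_derivative Fp' c0 c1 c2 c3 c4 x) (at x)"
  unfolding Fp_def[abs_def] Fp'_def
  by (auto intro!: derivative_eq_intros simp: power2_eq_square power3_eq_cube algebra_simps)

lemma comb_diagonal: "comb c0 c1 c2 c3 c4 x y y = y^5 * Fp c0 c1 c2 c3 c4 (x / y)" if "y \<noteq> 0"
proof -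
  define z where "z = x / y"
  have x: "x = z * y" using that by (simp add: z_def)
  show ?thesis unfolding z_def[symmetric] unfolding x
    unfolding comb_def s0_def s1_def s2_def s3_def s4_def Sn_def Tmn_def Smn_def Uf_def Fp_def by simp algebra
qed

lemma comb_edge: "comb c0 c1 c2 c3 c4 x y 0 = (x+y) * (x*y)^2 * Qp c0 c1 c2 ((x-y)^2/(x*y))"
  if "x \<noteq> 0" "y \<noteq> 0"
proof -
  define w where "w = (x-y)^2/(x*y)"
  have w: "w * (x*y) = (x-y)^2" using that by (simp add: w_def)
  have "comb c0 c1 c2 c3 c4 x y 0 =
      (x+y) * (c0 * ((x-y)^2)^2 + (3*c0+c1)*((x-y)^2)*(x*y) + (c0+c1+c2)*(x*y)^2)"
    unfolding comb_def s0_def s1_def s2_def s3_def s4_def Sn_def Tmn_def Smn_def Uf_def by simp algebra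
  also have "\<dots> = (x+y) * (x*y)^2 * Qp c0 c1 c2 w"
    unfolding w[symmetric] Qp_def by algebra
  finally show ?thesis unfolding w_def .
qed

lemma comb_axis: "comb c0 c1 c2 c3 c4 x 0 0 = c0 * x^5" "comb c0 c1 c2 c3 c4 0 x 0 = c0 * x^5"
  unfolding comb_def s0_def s1_def s2_def s3_def s4_def Sn_def Tmn_def Smn_def Uf_def by simp_all

text \<open>Also serves for other polynomials: any quadratic a w^2 + b w + c equals
  \<open>Qp a (b-3*a) (c-b+2*a) w\<close>, so the sign of its leading coefficient can be read off
  here.\<close>

lemma Qp_nonneg_leading:
  assumes "\<And>w. w \<ge> 0 \<Longrightarrow> Qp c0 c1 c2 w \<ge> 0" shows "c0 \<ge> 0"
proof (rule ccontr)
  assume "\<not> c0 \<ge> 0"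
  \<comment> \<open>Chosen so that c0 w = c0 - |3 c0 + c1| - |c0 + c1 + c2|; then c0 w^2 outweighs
    the two lower terms.\<close>
  define w where "w = (\<bar>3*c0+c1\<bar> + \<bar>c0+c1+c2\<bar>) / (-c0) + 1"
  have c: "c0 < 0" using \<open>\<not> c0 \<ge> 0\<close> by simp
  have "(\<bar>3*c0+c1\<bar> + \<bar>c0+c1+c2\<bar>) / (-c0) \<ge> 0" using c by (intro divide_nonneg_pos) auto
  hence w1: "w \<ge> 1" unfolding w_def by linarith
  have "-c0*(w-1) = \<bar>3*c0+c1\<bar> + \<bar>c0+c1+c2\<bar>" using c unfolding w_def by simp
  hence "c0*w = c0 - \<bar>3*c0+c1\<bar> - \<bar>c0+c1+c2\<bar>" by (simp add: algebra_simps)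
  hence "c0*w^2 = (c0 - \<bar>3*c0+c1\<bar> - \<bar>c0+c1+c2\<bar>) * w" by (simp add: power2_eq_square)
  hence "Qp c0 c1 c2 w = c0*w + ((3*c0+c1) - \<bar>3*c0+c1\<bar>)*w + ((c0+c1+c2) - \<bar>c0+c1+c2\<bar>*w)"
    unfolding Qp_def by (simp add: algebra_simps)
  moreover have "((3*c0+c1) - \<bar>3*c0+c1\<bar>)*w \<le> 0" using w1 by (intro mult_nonpos_nonneg) auto
  moreover have "\<bar>c0+c1+c2\<bar>*w \<ge> \<bar>c0+c1+c2\<bar>*1" using w1 by (intro mult_left_mono) auto
  hence "\<bar>c0+c1+c2\<bar>*w \<ge> c0+c1+c2" using abs_ge_self[of "c0+c1+c2"] by simp
  moreover have "c0*w < 0" using c w1 by (intro mult_neg_pos) auto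
  ultimately have "Qp c0 c1 c2 w < 0" by linarith
  thus False using assms[of w] w1 by simp
qed

text \<open>Degree five leaves no room for r^2, since r has degree three; hence the dependence on r
  is affine.\<close>

lemma comb_pqr:
  fixes a b c :: real
  defines "p \<equiv> a+b+c" and "q \<equiv> a*b+b*c+c*a" and "r \<equiv> a*b*c"
  shows "comb c0 c1 c2 c3 c4 a b c =
    (c0*(p^5 - 5*p^3*q + 5*p*q^2) + c1*(p^3*q - 3*p*q^2) + c2*(p*q^2))
    + (c0*(5*p^2 - 6*q) + c1*(3*q - p^2) + c2*(-2*p^2-3*q) + c3*(p^2-3*q) + c4*q) * r"
  unfolding comb_def s0_def s1_def s2_def s3_def s4_def Sn_def Tmn_def Smn_def Uf_def p_def q_def r_def
  by simp algebra

lemma affine_nonneg_between: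
  fixes A B r r1 r2 :: real
  assumes "A + B*r1 \<ge> 0" "A + B*r2 \<ge> 0" "r1 \<le> r" "r \<le> r2"
  shows "A + B*r \<ge> 0"
proof (cases "B \<ge> 0")
  case True thus ?thesis using mult_left_mono[OF assms(3) True] assms(1) by linarith
next
  case False thus ?thesis using mult_left_mono_neg[OF assms(4), of B] assms(2) by linarith
qed

text \<open>For fixed elementary symmetric functions \<open>p\<close> and \<open>q\<close> a symmetric quintic is affine in
  \<open>r = abc\<close>, and \<open>r\<close> is extremal at points with two equal coordinates or with a zero coordinate.\<close>

lemma comb_nonneg_sorted:
  assumes N: "nonneg_coeffs c0 c1 c2 c3 c4" and abc: "0 \<le> a" "a \<le> b" "b \<le> c"
  shows "comb c0 c1 c2 c3 c4 a b c \<ge> 0"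
proof -
  define p q r where "p = a+b+c" and "q = a*b+b*c+c*a" and "r = a*b*c"
  define A B where "A = c0*(p^5 - 5*p^3*q + 5*p*q^2) + c1*(p^3*q - 3*p*q^2) + c2*(p*q^2)"
    and "B = c0*(5*p^2 - 6*q) + c1*(3*q - p^2) + c2*(-2*p^2-3*q) + c3*(p^2-3*q) + c4*q"
  have fAB: "comb c0 c1 c2 c3 c4 x y z = A + B * (x*y*z)" if "x+y+z = p" "x*y+y*z+z*x = q" for x y z
    using comb_pqr[of c0 c1 c2 c3 c4 x y z] unfolding that A_def B_def .
  have c0: "c0 \<ge> 0" using N Qp_nonneg_leading unfolding nonneg_coeffs_def by blast
  have diag: "comb c0 c1 c2 c3 c4 x y y \<ge> 0" if "x \<ge> 0" "y \<ge> 0" for x y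
  proof (cases "y = 0")
    case True thus ?thesis using c0 that by (simp add: comb_axis)
  next
    case False thus ?thesis using N that by (simp add: comb_diagonal nonneg_coeffs_def)
  qed
  have edge: "comb c0 c1 c2 c3 c4 x y 0 \<ge> 0" if "x \<ge> 0" "y \<ge> 0" for x y
  proof (cases "x = 0 \<or> y = 0")
    case True thus ?thesis using c0 that by (auto simp add: comb_axis)
  next
    case False thus ?thesis using N that by (simp add: comb_edge nonneg_coeffs_def)
  qed
  have disc: "p^2 - 3*q = ((a-b)^2 + (b-c)^2 + (c-a)^2)/2"
    unfolding p_def q_def by (simp add: power2_eq_square field_simps)
  define d where "d = sqrt (p^2 - 3*q)"
  have "p^2 - 3*q \<ge> 0" unfolding disc by simp
  hence d2: "d^2 = p^2 - 3*q" and d0: "d \<ge> 0" unfolding d_def by auto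
  have q0: "q \<ge> 0" unfolding q_def using abc by simp
  have p0: "p \<ge> 0" unfolding p_def using abc by simp
  have "d^2 \<le> p^2" using d2 q0 by linarith
  hence dp: "d \<le> p" using p0 by (rule power2_le_imp_le)
  \<comment> \<open>The triple (p-2y, y, y) has second symmetric function q exactly when 3y^2 - 2py
    + q = 0, with roots y1 and y2. These are the critical points of (y-a)(y-b)(y-c), so they
    interlace a, b, c, as the next estimates verify.\<close>
  define y1 y2 where "y1 = (p+d)/3" and "y2 = (p-d)/3"
  have "d^2 - (3*b-p)^2 = 3*((c-b)*(b-a))"
    using d2 unfolding p_def q_def by algebra
  moreover have "0 \<le> (c-b)*(b-a)" using abc by simp
  ultimately have "(3*b-p)^2 \<le> d^2" by linarith
  hence "\<bar>3*b-p\<bar> \<le> d" using d0 by (simp add: abs_le_square_iff[symmetric])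
  hence b: "y2 \<le> b" "b \<le> y1" unfolding y1_def y2_def by auto
  have "(p-3*a)^2 - d^2 = 3*((c-a)*(b-a))"
    using d2 unfolding p_def q_def by algebra
  moreover have "0 \<le> (c-a)*(b-a)" using abc by simp
  ultimately have "d^2 \<le> (p-3*a)^2" by linarith
  moreover have "0 \<le> p-3*a" using abc unfolding p_def by linarith
  ultimately have "d \<le> p-3*a" by (rule power2_le_imp_le)
  hence a: "a \<le> y2" unfolding y2_def by auto
  have "(3*c-p)^2 - d^2 = 3*((c-a)*(c-b))"
    using d2 unfolding p_def q_def by algebra
  moreover have "0 \<le> (c-a)*(c-b)" using abc by simp
  ultimately have "d^2 \<le> (3*c-p)^2" by linarith
  moreover have "0 \<le> 3*c-p" using abc unfolding p_def by linarith
  ultimately have "d \<le> 3*c-p" by (rule power2_le_imp_le)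
  hence c: "y1 \<le> c" unfolding y1_def by auto
  have y1q: "(p-2*y1)*y1 + y1*y1 + y1*(p-2*y1) = q"
  proof -
    have "(p-2*y1)*y1 + y1*y1 + y1*(p-2*y1) = (p^2 - d^2)/3"
      unfolding y1_def by (simp add: power2_eq_square field_simps)
    thus ?thesis unfolding d2 by simp
  qed
  have y2q: "(p-2*y2)*y2 + y2*y2 + y2*(p-2*y2) = q"
  proof -
    have "(p-2*y2)*y2 + y2*y2 + y2*(p-2*y2) = (p^2 - d^2)/3"
      unfolding y2_def by (simp add: power2_eq_square field_simps)
    thus ?thesis unfolding d2 by simp
  qed
  have cubic: "(p-2*y)*y*y - r = (y-a)*(y-b)*(y-c)" if "(p-2*y)*y + y*y + y*(p-2*y) = q" for y
    using that unfolding p_def q_def r_def by algebra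
  have "(y2-a)*(y2-b)*(y2-c) \<ge> 0"
    using a b c by (intro mult_nonpos_nonpos mult_nonneg_nonpos) auto
  hence r2: "r \<le> (p-2*y2)*y2*y2" using cubic[OF y2q] by linarith
  have v2: "A + B * ((p-2*y2)*y2*y2) \<ge> 0"
    using diag[of "p-2*y2" y2] fAB[OF _ y2q] d0 dp by (simp add: y2_def)
  have "\<exists>r1. r1 \<le> r \<and> A + B*r1 \<ge> 0"
  proof (cases "p - 2*y1 \<ge> 0")
    case True
    have "(y1-a)*(y1-b)*(y1-c) \<le> 0"
      using a b c by (intro mult_nonneg_nonpos mult_nonneg_nonneg) auto
    hence "(p-2*y1)*y1*y1 \<le> r" using cubic[OF y1q] by linarith
    moreover have "A + B * ((p-2*y1)*y1*y1) \<ge> 0"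
      using diag[of "p-2*y1" y1] fAB[OF _ y1q] True d0 p0 by (simp add: y1_def)
    ultimately show ?thesis by blast
  next
    case False
    \<comment> \<open>Here the triple with two equal coordinates y1 has left the orthant. The triple
      with a zero coordinate replaces it; its other coordinates (p+e)/2 and (p-e)/2 are real because
      p \<le> 2d gives p^2 \<ge> 4q.\<close>
    hence "p \<le> 2*d" by (simp add: y1_def)
    hence "p^2 \<le> (2*d)^2" using p0 by (intro power_mono)
    hence pq: "p^2 - 4*q \<ge> 0" using d2 by (simp add: power_mult_distrib)
    define e where "e = sqrt (p^2-4*q)"
    have e2: "e^2 = p^2-4*q" and e0: "e \<ge> 0" unfolding e_def using pq by auto
    have "e^2 \<le> p^2" using e2 q0 by linarith
    hence ep: "e \<le> p" using p0 by (rule power2_le_imp_le)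
    have sum: "(p+e)/2 + (p-e)/2 + 0 = p" by (simp add: field_simps)
    have "((p+e)/2)*((p-e)/2) + ((p-e)/2)*0 + 0*((p+e)/2) = (p^2-e^2)/4"
      by (simp add: power2_eq_square field_simps)
    also have "\<dots> = q" unfolding e2 by simp
    finally have "A + B * (((p+e)/2)*((p-e)/2)*0) \<ge> 0"
      using edge[of "(p+e)/2" "(p-e)/2"] fAB[OF sum] e0 ep by simp
    moreover have "0 \<le> r" unfolding r_def using abc by simp
    ultimately show ?thesis by auto
  qed
  then obtain r1 where "r1 \<le> r" "A + B*r1 \<ge> 0" by blast
  hence "A + B*r \<ge> 0" using affine_nonneg_between v2 r2 by blast
  thus ?thesis using fAB[of a b c] unfolding p_def q_def r_def by simp
qed

lemma comb_swap:
  "comb c0 c1 c2 c3 c4 a b c = comb c0 c1 c2 c3 c4 b a c"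
  "comb c0 c1 c2 c3 c4 a b c = comb c0 c1 c2 c3 c4 a c b"
  unfolding comb_def s0_def s1_def s2_def s3_def s4_def Sn_def Tmn_def Smn_def Uf_def by (simp_all add: algebra_simps)

lemma comb_in_Ps35_iff: "comb c0 c1 c2 c3 c4 \<in> Ps35 \<longleftrightarrow> nonneg_coeffs c0 c1 c2 c3 c4"
proof
  assume N: "nonneg_coeffs c0 c1 c2 c3 c4"
  have "comb c0 c1 c2 c3 c4 a b c \<ge> 0" if "a \<ge> 0" "b \<ge> 0" "c \<ge> 0" for a b c
  proof -
    note nn = comb_nonneg_sorted[OF N]
    consider "a \<le> b" "b \<le> c" | "a \<le> c" "c \<le> b" | "b \<le> a" "a \<le> c" | "b \<le> c" "c \<le> a"
      | "c \<le> a" "a \<le> b" | "c \<le> b" "b \<le> a" by linarith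
    thus ?thesis
    proof cases
      case 1 thus ?thesis using nn[of a b c] that by simp
    next
      case 2 thus ?thesis using nn[of a c b] that comb_swap(2)[of _ _ _ _ _ a b c] by simp
    next
      case 3 thus ?thesis using nn[of b a c] that comb_swap(1)[of _ _ _ _ _ a b c] by simp
    next
      case 4 thus ?thesis
        using nn[of b c a] that comb_swap(1)[of _ _ _ _ _ a b c] comb_swap(2)[of _ _ _ _ _ b a c] by simp
    next
      case 5 thus ?thesis
        using nn[of c a b] that comb_swap(2)[of _ _ _ _ _ a b c] comb_swap(1)[of _ _ _ _ _ a c b] by simp
    next
      case 6 thus ?thesis
        using nn[of c b a] that comb_swap(1)[of _ _ _ _ _ a b c] comb_swap(2)[of _ _ _ _ _ b a c]
          comb_swap(1)[of _ _ _ _ _ b c a] by simp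
    qed
  qed
  thus "comb c0 c1 c2 c3 c4 \<in> Ps35" unfolding Ps35_def Hs35_def by blast
next
  assume "comb c0 c1 c2 c3 c4 \<in> Ps35"
  hence P: "comb c0 c1 c2 c3 c4 a b c \<ge> 0" if "a \<ge> 0" "b \<ge> 0" "c \<ge> 0" for a b c
    using that unfolding Ps35_def by blast
  have "Fp c0 c1 c2 c3 c4 x \<ge> 0" if "x \<ge> 0" for x
    using P[of x 1 1] that comb_diagonal[of 1] by simp
  moreover have "Qp c0 c1 c2 w \<ge> 0" if w: "w \<ge> 0" for w
  proof -
    \<comment> \<open>The larger solution of x + 1/x - 2 = w, so that the edge point (x, 1, 0) has
      parameter w.\<close>
    define e x where "e = sqrt ((w+2)^2 - 4)" and "x = (w + 2 + e)/2"
    have "(w+2)^2 \<ge> 2^2" using w by (intro power_mono) auto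
    hence e: "e \<ge> 0" "e^2 = (w+2)^2 - 4" unfolding e_def by auto
    have x: "x > 0" unfolding x_def using e w by simp
    have "(x-1)^2 - w*x = (e^2 - ((w+2)^2 - 4))/4"
      unfolding x_def by (simp add: power2_eq_square field_simps)
    hence "(x-1)^2/(x*1) = w" using x e by (simp add: field_simps)
    hence "comb c0 c1 c2 c3 c4 x 1 0 = (x+1)*x^2 * Qp c0 c1 c2 w"
      using comb_edge[of x 1] x by simp
    moreover have "(x+1)*x^2 > 0" using x by simp
    moreover have "comb c0 c1 c2 c3 c4 x 1 0 \<ge> 0" using P x by simp
    ultimately show ?thesis by (metis zero_le_mult_iff not_less)
  qed
  ultimately show "nonneg_coeffs c0 c1 c2 c3 c4" unfolding nonneg_coeffs_def by blast
qed

subsection \<open>Extremality and perturbations\<close>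

text \<open>Later statements keep terms such as \<open>c0-1*d0\<close> or \<open>c0-e*0\<close>
  unsimplified so that these equations match them.\<close>

lemma Fp_linear:
  "Fp (c0-r*d0) (c1-r*d1) (c2-r*d2) (c3-r*d3) (c4-r*d4) x = Fp c0 c1 c2 c3 c4 x - r * Fp d0 d1 d2 d3 d4 x"
  "Fp' (c0-r*d0) (c1-r*d1) (c2-r*d2) (c3-r*d3) (c4-r*d4) x = Fp' c0 c1 c2 c3 c4 x - r * Fp' d0 d1 d2 d3 d4 x"
  "Qp (c0-r*d0) (c1-r*d1) (c2-r*d2) x = Qp c0 c1 c2 x - r * Qp d0 d1 d2 x"
  unfolding Fp_def Fp'_def Qp_def by algebra+

lemma comb_linear:
  "comb (c0-r*d0) (c1-r*d1) (c2-r*d2) (c3-r*d3) (c4-r*d4) x y z =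
     comb c0 c1 c2 c3 c4 x y z - r * comb d0 d1 d2 d3 d4 x y z"
  unfolding comb_def by (simp add: algebra_simps)

text \<open>Restriction to (x, 1, 1) loses nothing, so identities between forms can be checked on
  univariate quintics.\<close>

lemma Fp_zero_coeffs:
  assumes "\<And>x. x \<ge> 0 \<Longrightarrow> Fp c0 c1 c2 c3 c4 x = 0"
  shows "c0 = 0 \<and> c1 = 0 \<and> c2 = 0 \<and> c3 = 0 \<and> c4 = 0"
proof -
  have c4: "c4 = 0" using assms[of 1] by (simp add: Fp_def)
  have c2: "c2 = - c0 - c1" using assms[of 0] by (simp add: Fp_def)
  have "9*c0 + 6*c1 + c3 = 0" using assms[of 2] c2 c4 by (simp add: Fp_def)
  moreover have "16*c0 + 8*c1 + c3 = 0" using assms[of 3] c2 c4 by (simp add: Fp_def)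
  moreover have "25*c0 + 10*c1 + c3 = 0" using assms[of 4] c2 c4 by (simp add: Fp_def)
  ultimately show ?thesis using c2 c4 by simp
qed

lemma Fp_eq_coeffs:
  assumes "\<And>x. x \<ge> 0 \<Longrightarrow> Fp c0 c1 c2 c3 c4 x = r * Fp d0 d1 d2 d3 d4 x"
  shows "c0 = r*d0 \<and> c1 = r*d1 \<and> c2 = r*d2 \<and> c3 = r*d3 \<and> c4 = r*d4"
  using Fp_zero_coeffs[of "c0-r*d0" "c1-r*d1" "c2-r*d2" "c3-r*d3" "c4-r*d4"] assms
  by (simp add: Fp_linear)

lemma comb_eq_coeffs:
  assumes "comb c0 c1 c2 c3 c4 = scalef r (comb d0 d1 d2 d3 d4)"
  shows "c0 = r*d0 \<and> c1 = r*d1 \<and> c2 = r*d2 \<and> c3 = r*d3 \<and> c4 = r*d4"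
proof (rule Fp_eq_coeffs)
  fix x
  have "comb c0 c1 c2 c3 c4 x 1 1 = r * comb d0 d1 d2 d3 d4 x 1 1"
    unfolding assms by (simp add: scalef_def)
  thus "Fp c0 c1 c2 c3 c4 x = r * Fp d0 d1 d2 d3 d4 x" by (simp add: comb_diagonal)
qed

lemma scalef_comb: "scalef r (comb c0 c1 c2 c3 c4) = comb (r*c0) (r*c1) (r*c2) (r*c3) (r*c4)"
  unfolding scalef_def comb_def by (simp add: algebra_simps)

lemma comb_zero: "comb 0 0 0 0 0 = (\<lambda>a b c. 0)"
  unfolding comb_def by simp

lemma comb_eq_zero: "comb c0 c1 c2 c3 c4 = (\<lambda>a b c. 0) \<longleftrightarrow> c0 = 0 \<and> c1 = 0 \<and> c2 = 0 \<and> c3 = 0 \<and> c4 = 0"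
  using comb_eq_coeffs[of c0 c1 c2 c3 c4 0 0 0 0 0 0] comb_zero by (auto simp: scalef_def)

lemma in_Ps35_E:
  assumes "g \<in> Ps35"
  obtains d0 d1 d2 d3 d4 where "g = comb d0 d1 d2 d3 d4" "nonneg_coeffs d0 d1 d2 d3 d4"
proof -
  obtain d0 d1 d2 d3 d4 where "g = comb d0 d1 d2 d3 d4" using assms unfolding Ps35_def Hs35_def by blast
  thus ?thesis using that assms comb_in_Ps35_iff by blast
qed

lemma scalef_nonneg_factor:
  assumes "f \<in> Ps35" "f \<noteq> (\<lambda>a b c. 0)" "scalef r f \<in> Ps35"
  shows "r \<ge> 0"
proof (rule ccontr)
  assume r: "\<not> r \<ge> 0"
  obtain c0 c1 c2 c3 c4 where f: "f = comb c0 c1 c2 c3 c4" and c: "nonneg_coeffs c0 c1 c2 c3 c4"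
    using assms(1) by (rule in_Ps35_E)
  have "Fp c0 c1 c2 c3 c4 x = 0" if "x \<ge> 0" for x
  proof -
    have "scalef r f x 1 1 \<ge> 0" using assms(3) that unfolding Ps35_def by auto
    hence "r * Fp c0 c1 c2 c3 c4 x \<ge> 0" by (simp add: f scalef_def comb_diagonal)
    moreover have "Fp c0 c1 c2 c3 c4 x \<ge> 0" using c that unfolding nonneg_coeffs_def by blast
    ultimately show ?thesis using r by (metis zero_le_mult_iff linorder_not_le order_antisym)
  qed
  thus False using Fp_zero_coeffs assms(2) unfolding f comb_eq_zero by blast
qed

text \<open>A summand g of f in the cone satisfies 0 \<le> g \<le> f, and this squeeze is all that
  the individual extremality proofs exploit. The sign of the factor r comes from
  \<open>scalef_nonneg_factor\<close>, the other summand from symmetry.\<close>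

lemma extremal_combI:
  assumes c: "nonneg_coeffs c0 c1 c2 c3 c4"
    and nz: "c0 \<noteq> 0 \<or> c1 \<noteq> 0 \<or> c2 \<noteq> 0 \<or> c3 \<noteq> 0 \<or> c4 \<noteq> 0"
    and dom: "\<And>d0 d1 d2 d3 d4. nonneg_coeffs d0 d1 d2 d3 d4 \<Longrightarrow>
        (\<And>x. x \<ge> 0 \<Longrightarrow> Fp d0 d1 d2 d3 d4 x \<le> Fp c0 c1 c2 c3 c4 x) \<Longrightarrow>
        (\<And>w. w \<ge> 0 \<Longrightarrow> Qp d0 d1 d2 w \<le> Qp c0 c1 c2 w) \<Longrightarrow>
        \<exists>r. d0 = r*c0 \<and> d1 = r*c1 \<and> d2 = r*c2 \<and> d3 = r*c3 \<and> d4 = r*c4"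
  shows "extremal Ps35 (comb c0 c1 c2 c3 c4)"
proof -
  define f where "f = comb c0 c1 c2 c3 c4"
  have fP: "f \<in> Ps35" using c unfolding f_def comb_in_Ps35_iff .
  have f0: "f \<noteq> (\<lambda>a b c. 0)" unfolding f_def comb_eq_zero using nz by auto
  have main: "\<exists>r\<ge>0. g = scalef r f" if g: "g \<in> Ps35" and h: "h \<in> Ps35" and s: "f = addf g h" for g h
  proof -
    obtain d0 d1 d2 d3 d4 where gd: "g = comb d0 d1 d2 d3 d4" and d: "nonneg_coeffs d0 d1 d2 d3 d4"
      using g by (rule in_Ps35_E)
    have "h a b c = comb (c0-1*d0) (c1-1*d1) (c2-1*d2) (c3-1*d3) (c4-1*d4) a b c" for a b c
      using fun_cong[OF fun_cong[OF fun_cong[OF s]], of a b c] unfolding comb_linear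
      by (simp add: addf_def f_def gd)
    hence "h = comb (c0-1*d0) (c1-1*d1) (c2-1*d2) (c3-1*d3) (c4-1*d4)" by blast
    hence n: "nonneg_coeffs (c0-1*d0) (c1-1*d1) (c2-1*d2) (c3-1*d3) (c4-1*d4)"
      using h comb_in_Ps35_iff by blast
    have "\<exists>r. d0 = r*c0 \<and> d1 = r*c1 \<and> d2 = r*c2 \<and> d3 = r*c3 \<and> d4 = r*c4"
    proof (rule dom[OF d])
      show "Fp d0 d1 d2 d3 d4 x \<le> Fp c0 c1 c2 c3 c4 x" if "x \<ge> 0" for x
        using n that unfolding nonneg_coeffs_def Fp_linear by simp
      show "Qp d0 d1 d2 w \<le> Qp c0 c1 c2 w" if "w \<ge> 0" for w
        using n that unfolding nonneg_coeffs_def Fp_linear by simp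
    qed
    then obtain r where "g = scalef r f" unfolding gd f_def scalef_comb by blast
    moreover from this have "r \<ge> 0" using scalef_nonneg_factor fP f0 g by blast
    ultimately show ?thesis by blast
  qed
  have "(\<exists>r\<ge>0. g = scalef r f) \<and> (\<exists>r\<ge>0. h = scalef r f)"
    if "g \<in> Ps35" "h \<in> Ps35" "f = addf g h" for g h
  proof
    have "f = addf h g" using that(3) by (simp add: addf_def add.commute)
    thus "\<exists>r\<ge>0. h = scalef r f" using main that by blast
  qed (use main that in blast)
  thus ?thesis using fP f0 unfolding extremal_def f_def by blast
qed

lemma extremal_scalef:
  assumes "extremal Ps35 f" "r > 0"
  shows "extremal Ps35 (scalef r f)"
proof -
  have P: "scalef q g \<in> Ps35" if "g \<in> Ps35" "q \<ge> 0" for q g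
  proof -
    obtain d0 d1 d2 d3 d4 where g: "g = comb d0 d1 d2 d3 d4" using \<open>g \<in> Ps35\<close> by (rule in_Ps35_E)
    have "scalef q g \<in> Hs35" unfolding g scalef_comb Hs35_def by blast
    thus ?thesis using that unfolding Ps35_def by (auto simp: scalef_def)
  qed
  have inv: "g = scalef q (scalef r f)" if "scalef (1/r) g = scalef q f" for g q
  proof -
    have "g a b c = q * (r * f a b c)" for a b c
      using fun_cong[OF fun_cong[OF fun_cong[OF that]], of a b c] \<open>r > 0\<close>
      by (simp add: scalef_def field_simps)
    thus ?thesis unfolding scalef_def by blast
  qed
  have "(\<exists>q\<ge>0. g = scalef q (scalef r f)) \<and> (\<exists>q\<ge>0. h = scalef q (scalef r f))"
    if gh: "g \<in> Ps35" "h \<in> Ps35" "scalef r f = addf g h" for g h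
  proof -
    have "f a b c = scalef (1/r) g a b c + scalef (1/r) h a b c" for a b c
      using fun_cong[OF fun_cong[OF fun_cong[OF gh(3)]], of a b c] \<open>r > 0\<close>
      by (simp add: scalef_def addf_def field_simps)
    hence "f = addf (scalef (1/r) g) (scalef (1/r) h)" unfolding addf_def by blast
    moreover have "scalef (1/r) g \<in> Ps35" "scalef (1/r) h \<in> Ps35" using P gh \<open>r > 0\<close> by simp_all
    ultimately have "(\<exists>q\<ge>0. scalef (1/r) g = scalef q f) \<and> (\<exists>q\<ge>0. scalef (1/r) h = scalef q f)"
      using assms(1) unfolding extremal_def by blast
    thus ?thesis using inv by blast
  qed
  moreover have "scalef r f \<noteq> (\<lambda>a b c. 0)"
  proof
    assume z: "scalef r f = (\<lambda>a b c. 0)"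
    have "f a b c = 0" for a b c
      using fun_cong[OF fun_cong[OF fun_cong[OF z]], of a b c] \<open>r > 0\<close> by (simp add: scalef_def)
    thus False using assms(1) unfolding extremal_def by blast
  qed
  moreover have "scalef r f \<in> Ps35" using assms P unfolding extremal_def by simp
  ultimately show ?thesis unfolding extremal_def by blast
qed

lemma extremal_subtract:
  assumes "extremal Ps35 (comb c0 c1 c2 c3 c4)" "nonneg_coeffs d0 d1 d2 d3 d4"
    and "nonneg_coeffs (c0-d0) (c1-d1) (c2-d2) (c3-d3) (c4-d4)"
  shows "\<exists>r\<ge>0. d0 = r*c0 \<and> d1 = r*c1 \<and> d2 = r*c2 \<and> d3 = r*c3 \<and> d4 = r*c4"
proof -
  have "comb c0 c1 c2 c3 c4 = addf (comb d0 d1 d2 d3 d4) (comb (c0-d0) (c1-d1) (c2-d2) (c3-d3) (c4-d4))"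
    unfolding addf_def comb_def by (simp add: algebra_simps)
  hence "\<exists>r\<ge>0. comb d0 d1 d2 d3 d4 = scalef r (comb c0 c1 c2 c3 c4)"
    using assms unfolding comb_in_Ps35_iff[symmetric] extremal_def by blast
  thus ?thesis using comb_eq_coeffs by blast
qed

lemma nonneg_coeffs_scale:
  assumes "nonneg_coeffs d0 d1 d2 d3 d4" "e \<ge> 0"
  shows "nonneg_coeffs (e*d0) (e*d1) (e*d2) (e*d3) (e*d4)"
proof -
  have "Fp (e*d0) (e*d1) (e*d2) (e*d3) (e*d4) x = e * Fp d0 d1 d2 d3 d4 x"
    "Qp (e*d0) (e*d1) (e*d2) x = e * Qp d0 d1 d2 x" for x
    unfolding Fp_def Qp_def by algebra+
  thus ?thesis using assms unfolding nonneg_coeffs_def by simp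
qed

lemma extremal_subtract_multiple:
  assumes "extremal Ps35 (comb c0 c1 c2 c3 c4)" "nonneg_coeffs d0 d1 d2 d3 d4" "e > 0"
    and "nonneg_coeffs (c0-e*d0) (c1-e*d1) (c2-e*d2) (c3-e*d3) (c4-e*d4)"
  shows "\<exists>r\<ge>0. d0 = r*c0 \<and> d1 = r*c1 \<and> d2 = r*c2 \<and> d3 = r*c3 \<and> d4 = r*c4"
proof -
  obtain r where r: "r \<ge> 0" "e*d0 = r*c0 \<and> e*d1 = r*c1 \<and> e*d2 = r*c2 \<and> e*d3 = r*c3 \<and> e*d4 = r*c4"
    using extremal_subtract[OF assms(1) nonneg_coeffs_scale[OF assms(2)] assms(4)] assms(3) by auto
  have "d0 = (r/e)*c0 \<and> d1 = (r/e)*c1 \<and> d2 = (r/e)*c2 \<and> d3 = (r/e)*c3 \<and> d4 = (r/e)*c4"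
    using r assms(3) by (simp add: field_simps)
  thus ?thesis using r(1) assms(3) by (intro exI[of _ "r/e"]) simp
qed

text \<open>f is the midpoint of f - e d and f + e d. The two-sided form is what the direction
  \<open>eE t\<close> requires, since for t < 7 it lies outside the cone.\<close>

lemma extremal_perturb:
  assumes "extremal Ps35 (comb c0 c1 c2 c3 c4)" "e > 0"
    and m: "nonneg_coeffs (c0-e*d0) (c1-e*d1) (c2-e*d2) (c3-e*d3) (c4-e*d4)"
    and p: "nonneg_coeffs (c0+e*d0) (c1+e*d1) (c2+e*d2) (c3+e*d3) (c4+e*d4)"
  shows "\<exists>r. d0 = r*c0 \<and> d1 = r*c1 \<and> d2 = r*c2 \<and> d3 = r*c3 \<and> d4 = r*c4"
proof -
  have "nonneg_coeffs (1/2*(c0-e*d0)) (1/2*(c1-e*d1)) (1/2*(c2-e*d2)) (1/2*(c3-e*d3)) (1/2*(c4-e*d4))"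
    using nonneg_coeffs_scale[OF m, of "1/2"] by simp
  moreover have half: "1/2*(c-e*d) = c - 1/2*(c+e*d)" for c d :: real by (simp add: field_simps)
  moreover have "nonneg_coeffs (1/2*(c0+e*d0)) (1/2*(c1+e*d1)) (1/2*(c2+e*d2)) (1/2*(c3+e*d3)) (1/2*(c4+e*d4))"
    using nonneg_coeffs_scale[OF p, of "1/2"] by simp
  ultimately have "\<exists>r\<ge>0. 1/2*(c0+e*d0) = r*c0 \<and> 1/2*(c1+e*d1) = r*c1 \<and> 1/2*(c2+e*d2) = r*c2
      \<and> 1/2*(c3+e*d3) = r*c3 \<and> 1/2*(c4+e*d4) = r*c4"
    unfolding half by (intro extremal_subtract[OF assms(1)])
  then obtain r where "1/2*(c0+e*d0) = r*c0 \<and> 1/2*(c1+e*d1) = r*c1 \<and> 1/2*(c2+e*d2) = r*c2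
      \<and> 1/2*(c3+e*d3) = r*c3 \<and> 1/2*(c4+e*d4) = r*c4" by blast
  moreover have "d = ((2*r-1)/e)*c" if "1/2*(c+e*d) = r*c" for c d
    using that \<open>e > 0\<close> by (simp add: field_simps)
  ultimately show ?thesis by blast
qed

section \<open>Double zeros of nonnegative functions on the half-line\<close>

lemma dominated_double_zero:
  fixes f g :: "real \<Rightarrow> real"
  assumes "(f has_real_derivative 0) (at t)" "f t = 0" "(g has_real_derivative D) (at t)"
    and bd: "\<And>x. x \<ge> 0 \<Longrightarrow> 0 \<le> g x" "\<And>x. x \<ge> 0 \<Longrightarrow> g x \<le> f x" and "t \<ge> 0"
  shows "g t = 0" "D = 0"
proof -
  show g: "g t = 0" using bd[of t] assms(2,6) by simp
  \<comment> \<open>One-sided quotients, because the bounds hold only for x \<ge> 0 and t may be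
    0.\<close>
  have f': "((\<lambda>h. (f (t+h) - f t)/h) \<longlongrightarrow> 0) (at_right 0)"
    using assms(1) unfolding DERIV_def by (rule filterlim_mono) (auto simp: at_le)
  have g': "((\<lambda>h. (g (t+h) - g t)/h) \<longlongrightarrow> D) (at_right 0)"
    using assms(3) unfolding DERIV_def by (rule filterlim_mono) (auto simp: at_le)
  have "((\<lambda>h. (g (t+h) - g t)/h) \<longlongrightarrow> 0) (at_right 0)"
  proof (rule tendsto_sandwich[OF _ _ tendsto_const f'])
    show "\<forall>\<^sub>F h in at_right 0. 0 \<le> (g (t+h) - g t)/h"
      using bd assms(6) g by (auto simp: eventually_at_filter)
    show "\<forall>\<^sub>F h in at_right 0. (g (t+h) - g t)/h \<le> (f (t+h) - f t)/h"
      using bd assms(6) g assms(2) by (auto simp: eventually_at_filter divide_right_mono)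
  qed
  thus "D = 0" using tendsto_unique[OF _ g'] by simp
qed

lemma nonneg_zero_deriv:
  fixes f :: "real \<Rightarrow> real"
  assumes "(f has_real_derivative D) (at t)" "f t = 0" "t > 0" "\<And>x. x \<ge> 0 \<Longrightarrow> 0 \<le> f x"
  shows "D = 0"
  using DERIV_local_min[OF assms(1), of t] assms by auto

text \<open>At a positive zero of a nonnegative function the derivative vanishes, so only 0 can be a
  zero here, and a simple one. Near 0 the function is therefore bounded below linearly, on a compact
  middle range by its positive minimum, and at infinity by the growth hypothesis.\<close>

lemma no_double_zero_bound:
  fixes f f' :: "real \<Rightarrow> real"
  assumes der: "\<And>x. (f has_real_derivative f' x) (at x)"
    and nn: "\<And>x. x \<ge> 0 \<Longrightarrow> f x \<ge> 0"
    and nz: "\<And>x. x \<ge> 0 \<Longrightarrow> f x = 0 \<Longrightarrow> f' x \<noteq> 0"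
    and inf: "d > 0" "\<And>x. x \<ge> N \<Longrightarrow> f x \<ge> d * x^2"
  shows "\<exists>e>0. \<forall>x\<ge>0. e * (x + x^2) \<le> f x"
proof -
  have pos: "f x > 0" if "x > 0" for x
    using nn[of x] nz[of x] nonneg_zero_deriv[OF der _ that nn] that by (cases "f x = 0") auto
  have cont: "isCont f x" for x using der DERIV_isCont by blast
  have "\<exists>h>0. \<exists>e>0. \<forall>x. 0 \<le> x \<and> x \<le> h \<longrightarrow> e * x \<le> f x"
  proof (cases "f 0 = 0")
    case False
    hence f0: "f 0 > 0" using nn[of 0] by simp
    have "\<forall>\<^sub>F x in at 0. f x > f 0 / 2"
      using order_tendstoD(1)[OF cont[of 0, unfolded isCont_def], of "f 0 / 2"] f0 by simp
    then obtain h where h: "h > 0" "\<And>x. x \<noteq> 0 \<Longrightarrow> \<bar>x\<bar> < h \<Longrightarrow> f x > f 0 / 2"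
      unfolding eventually_at by (auto simp: dist_real_def)
    have "f 0 / 2 / h * x \<le> f x" if "0 \<le> x" "x \<le> h/2" for x
    proof (cases "x = 0")
      case False
      have "f 0 / 2 / h * x \<le> f 0 / 2 / h * h" using that h f0 by (intro mult_left_mono) auto
      also have "\<dots> = f 0 / 2" using h by simp
      also have "\<dots> \<le> f x" using h(2)[OF False] that h(1) by simp
      finally show ?thesis .
    qed (use f0 in simp)
    moreover have "f 0 / 2 / h > 0" "h/2 > 0" using h f0 by simp_all
    ultimately show ?thesis by blast
  next
    case True
    have lim: "((\<lambda>h. f h/h) \<longlongrightarrow> f' 0) (at_right 0)"
    proof -
      have "((\<lambda>h. (f (0+h) - f 0)/h) \<longlongrightarrow> f' 0) (at_right 0)"
        using der[of 0] unfolding DERIV_def by (rule filterlim_mono) (auto simp: at_le)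
      thus ?thesis using True by simp
    qed
    have "\<forall>\<^sub>F h in at_right 0. 0 \<le> f h/h" using nn by (auto simp: eventually_at_filter)
    hence "f' 0 \<ge> 0" using tendsto_lowerbound[OF lim] by simp
    hence f0: "f' 0 > 0" using nz[of 0] True by simp
    have "\<forall>\<^sub>F x in at_right 0. f x / x > f' 0 / 2"
      using order_tendstoD(1)[OF lim, of "f' 0 / 2"] f0 by simp
    then obtain h where h: "h > 0" "\<And>x. 0 < x \<Longrightarrow> x < h \<Longrightarrow> f x / x > f' 0 / 2"
      unfolding eventually_at_right_field by auto
    have "f' 0 / 2 * x \<le> f x" if "0 \<le> x" "x \<le> h/2" for x
      using h(2)[of x] that h(1) True by (cases "x = 0") (auto simp: field_simps)
    moreover have "f' 0 / 2 > 0" "h/2 > 0" using h f0 by simp_all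
    ultimately show ?thesis by blast
  qed
  then obtain h e1 where h: "h > 0" and e1: "e1 > 0" "\<And>x. 0 \<le> x \<Longrightarrow> x \<le> h \<Longrightarrow> e1 * x \<le> f x"
    by blast
  define M where "M = max (max N 1) h"
  have "\<exists>y\<ge>h. y \<le> M \<and> (\<forall>x. h \<le> x \<and> x \<le> M \<longrightarrow> f y \<le> f x)"
    using isCont_eq_Lb[of h M f] cont unfolding M_def by force
  then obtain y where y: "y \<ge> h" "\<And>x. h \<le> x \<Longrightarrow> x \<le> M \<Longrightarrow> f y \<le> f x" by blast
  have fy: "f y > 0" using pos y h by simp
  have M: "M \<ge> 1" "M \<ge> N" "M \<ge> h" unfolding M_def by auto
  \<comment> \<open>One term for each of the ranges [0,h], [h,M] and beyond M; in the last, x + x^2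
    \<le> 2x^2 accounts for d/2.\<close>
  define e where "e = min (e1/(1+h)) (min (f y/(M+M^2)) (d/2))"
  have MM: "M + M^2 > 0" using M by (simp add: add_pos_pos)
  have e: "e > 0" unfolding e_def using e1 h fy MM inf(1) by simp
  have e': "e \<le> e1/(1+h)" "e \<le> f y/(M+M^2)" "e \<le> d/2"
    unfolding e_def by (simp_all only: min_le_iff_disj order_refl simp_thms)
  note e = e e'
  have "e * (x + x^2) \<le> f x" if "x \<ge> 0" for x
  proof -
    consider "x \<le> h" | "h \<le> x" "x \<le> M" | "M \<le> x" by linarith
    thus ?thesis
    proof cases
      case 1
      have "e * (x + x^2) = (e * (1+x)) * x" by (simp add: power2_eq_square algebra_simps)
      also have "e * (1+x) \<le> e1/(1+h) * (1+h)" using 1 that e e1 h by (intro mult_mono) auto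
      also have "e1/(1+h) * (1+h) = e1" using h by simp
      finally show ?thesis using e1(2)[OF that 1] that by (simp add: mult_right_mono order_trans)
    next
      case 2
      have "e * (x + x^2) \<le> f y/(M+M^2) * (M + M^2)"
        using 2 that e fy MM by (intro mult_mono add_mono power_mono) auto
      also have "\<dots> = f y" using MM by simp
      finally show ?thesis using y(2)[OF 2] by simp
    next
      case 3
      have "x + x^2 \<le> 2 * x^2" using 3 M mult_left_mono[of 1 x x] by (simp add: power2_eq_square)
      hence "e * (x + x^2) \<le> d/2 * (2 * x^2)" using e inf(1) that by (intro mult_mono) auto
      also have "\<dots> = d * x^2" by simp
      finally show ?thesis using inf(2)[of x] 3 M by simp
    qed
  qed
  thus ?thesis using e(1) by blast
qed

subsection \<open>Restrictions of the listed forms to the diagonal\<close>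

text \<open>\<open>sA\<close> is the paper's \<open>\<mu>\<^sub>Z\<close>: the second double root of \<open>eA t u x 1 1\<close>; its simple root is \<open>- kA\<close>.\<close>

definition sA :: "real \<Rightarrow> real \<Rightarrow> real" where
  "sA t u = ((t+2)*(7-t) - u) / ((t+2)*(5*t+1))"

definition kA :: "real \<Rightarrow> real \<Rightarrow> real" where
  "kA t u = 2*(t+2)*(9*(t-1)^2 - u) / ((5*t+1)*u)"

text \<open>For F = (x-t)^2 (x-s)^2 (x+k) this is 3F'(1) = 5F(1): the logarithmic derivative at 1
  equals 5/3, cleared of denominators.\<close>

lemma eA_relation:
  fixes t u :: real
  assumes "t \<ge> 0" "u > 0"
  shows "6*(1-sA t u)*(1+kA t u) + 6*(1-t)*(1+kA t u) + 3*(1-t)*(1-sA t u) = 5*(1-t)*(1-sA t u)*(1+kA t u)"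
proof -
  have nz: "t+2 \<noteq> 0" "5*t+1 \<noteq> 0" "u \<noteq> 0" using assms by auto
  show ?thesis unfolding sA_def kA_def using nz by (simp add: divide_simps) algebra
qed

text \<open>This and the next three identities match F with (x-t)^2 (x-s)^2 (x+k): the coefficient
  of x^4 here, then F(0), F(1), and the coefficient of x increased by 2F(0).\<close>

lemma pA1_eq:
  fixes t u :: real
  assumes "t \<ge> 0" "u > 0"
  shows "2 * pA1 t u = kA t u - 2*sA t u - 2*t"
proof -
  have nz: "t+2 \<noteq> 0" "5*t+1 \<noteq> 0" "u \<noteq> 0" using assms by auto
  show ?thesis unfolding sA_def kA_def pA1_def using nz by (simp add: divide_simps) algebra
qed

lemma pA2_eq:
  fixes t u :: real
  assumes "t \<ge> 0" "u > 0"
  shows "2 * (1 + pA1 t u + pA2 t u) = kA t u * t^2 * (sA t u)^2"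
proof -
  have nz: "t+2 \<noteq> 0" "5*t+1 \<noteq> 0" "u \<noteq> 0" using assms by auto
  show ?thesis unfolding sA_def kA_def pA1_def pA2_def using nz by (simp add: divide_simps) algebra
qed

lemma pA4_eq:
  fixes t u :: real
  assumes "t \<ge> 0" "u > 0"
  shows "3 * pA4 t u = (1-t)^2*(1-sA t u)^2*(1+kA t u)"
proof -
  have nz: "t+2 \<noteq> 0" "5*t+1 \<noteq> 0" "u \<noteq> 0" using assms by auto
  show ?thesis unfolding sA_def kA_def pA4_def using nz by (simp add: divide_simps) algebra
qed

lemma pA3_eq:
  fixes t u :: real
  assumes "t \<ge> 0" "u > 0"
  shows "3 + 4*pA1 t u + 2*pA2 t u + pA3 t u + pA4 t u =
    t^2*(sA t u)^2 - 2*kA t u*(t+sA t u)*t*sA t u + 2 * (kA t u * t^2 * (sA t u)^2)"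
proof -
  have nz: "t+2 \<noteq> 0" "5*t+1 \<noteq> 0" "u \<noteq> 0" using assms by auto
  show ?thesis unfolding sA_def kA_def pA1_def pA2_def pA3_def pA4_def
    using nz by (simp add: divide_simps) algebra
qed

text \<open>The first four conditions match the coefficients of x^4, x and 1 and the value at 1, so
  the two monic quintics differ by a constant times x^2 (x-1). The constant is proportional to the
  defect in the last hypothesis.\<close>

lemma Fp_from_zeros:
  fixes s t k :: real
  assumes c1: "2*c1 = k - 2*s - 2*t" and c2: "2*(1+c1+c2) = k*t^2*s^2"
    and c3: "3 + 4*c1 + 2*c2 + c3 + c4 = t^2*s^2 - 2*k*(t+s)*t*s + 2*(k*t^2*s^2)"
    and c4: "3*c4 = (1-t)^2*(1-s)^2*(1+k)"
    and rel: "6*(1-s)*(1+k) + 6*(1-t)*(1+k) + 3*(1-t)*(1-s) = 5*(1-t)*(1-s)*(1+k)"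
  shows "Fp 1 c1 c2 c3 c4 x = (x-t)^2*(x-s)^2*(x+k)"
proof -
  have c1': "c1 = (k - 2*s - 2*t)/2" using c1 by simp
  have c2': "c2 = k*t^2*s^2/2 - 1 - c1" using c2 by (simp add: field_simps)
  have c4': "c4 = (1-t)^2*(1-s)^2*(1+k)/3" using c4 by simp
  have c3': "c3 = t^2*s^2 - 2*k*(t+s)*t*s + 2*(k*t^2*s^2) - 3 - 4*c1 - 2*c2 - c4"
    using c3 by linarith
  have "Fp 1 c1 c2 c3 c4 x - (x-t)^2*(x-s)^2*(x+k) = x^2*(x-1)*((1-t)*(1-s)/3) *
     (5*(1-t)*(1-s)*(1+k) - (6*(1-s)*(1+k) + 6*(1-t)*(1+k) + 3*(1-t)*(1-s)))"
    unfolding Fp_def c3' unfolding c2' c4' c1' by (simp add: divide_simps) algebra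
  thus ?thesis unfolding rel by simp
qed

lemma Fp_eA:
  fixes t u :: real
  assumes "t \<ge> 0" "u > 0"
  shows "Fp 1 (pA1 t u) (pA2 t u) (pA3 t u) (pA4 t u) x = (x-t)^2*(x-sA t u)^2*(x+kA t u)"
  using pA1_eq[OF assms] pA2_eq[OF assms] pA3_eq[OF assms] pA4_eq[OF assms] eA_relation[OF assms]
  by (rule Fp_from_zeros)

text \<open>For t \<noteq> 1 this is, up to a positive factor, the limit of u times
  \<open>eA t u\<close> as u tends to 0: the simple root tends to minus infinity and the double root
  \<open>sA t u\<close> to (7-t)/(5t+1).\<close>

lemma Fp_eA_zero:
  fixes t :: real
  assumes "t \<ge> 0"
  shows "Fp 0 ((5*t+1)^2) ((t-1)^2*(t^2 - 12*t - 1))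
      (- 2*(t^4 + 36*t^3 + 34*t^2 + 60*t + 13)) (24*(t-1)^4) x =
    (x-t)^2*(x-(7-t)/(5*t+1))^2*(2*(5*t+1)^2)"
proof -
  have nz: "5*t+1 \<noteq> 0" using assms by auto
  show ?thesis unfolding Fp_def using nz by (simp add: divide_simps) algebra
qed

text \<open>\<open>pB4 t w\<close> is (t-1)^3/(t+2) times this quantity, so for t > 1 its sign is
  the sign of F(1) in family B.\<close>

definition eps :: "real \<Rightarrow> real \<Rightarrow> real" where
  "eps t w = t - 2 - 2*w - w^2/t^2"

text \<open>The cubic cofactor of (x-t)^2 in family B, arranged around x = 1 so that for x \<ge> 1
  and \<open>eps t w\<close> \<ge> 0 every term is visibly nonnegative.\<close>

definition GB :: "real \<Rightarrow> real \<Rightarrow> real \<Rightarrow> real" where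
  "GB t w x = (x-1)^2*(x + 2*w^2/t^2 + 2*eps t w) + (5*t+1)*eps t w/(t+2)*(x-1) + 3*(t-1)*eps t w/(t+2)"

lemma Fp_eB:
  fixes t w :: real
  assumes "t > 0"
  shows "Fp 1 (pB1 t w) (pB2 t w) (pB3 t w) (pB4 t w) x = (x-t)^2 * GB t w x"
proof -
  have nz: "t+2 \<noteq> 0" "t \<noteq> 0" using assms by auto
  show ?thesis unfolding Fp_def GB_def eps_def pB1_def pB2_def pB3_def pB4_def
    using nz by (simp add: divide_simps) algebra
qed

lemma Fp_eC: "Fp 1 (-(t+1)) t ((t+1)^2) 0 x = x*(x-1)^2*(x-t)^2"
  unfolding Fp_def by algebra

lemma Fp_eD: "Fp 0 1 (t^2-1) (-2*(t+1)^2) 0 x = 2*(x-1)^2*(x-t)^2"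
  unfolding Fp_def by algebra

lemma Fp_eE:
  fixes t :: real
  assumes "t \<ge> 0"
  shows "Fp 0 1 (-1) (- (4*t^2 + 5*t + 3) / (t+2)) ((t-1)^3 / (t+2)) x = (x-t)^2*(x*(2*x+(t-7)/(t+2)))"
proof -
  have nz: "t+2 \<noteq> 0" using assms by auto
  show ?thesis unfolding Fp_def using nz by (simp add: divide_simps) algebra
qed

section \<open>Family B: nonnegativity and the range of the parameters\<close>

lemma GB_nonneg:
  assumes t: "t \<ge> 2" and w: "w \<ge> 0" and e: "eps t w \<ge> 0" and x: "x \<ge> 0"
  shows "GB t w x \<ge> 0"
proof (cases "x \<ge> 1")
  case True
  thus ?thesis unfolding GB_def using t w e x by (intro add_nonneg_nonneg mult_nonneg_nonneg) auto
next
  case False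
  define E g r y where "E = eps t w" and "g = 2*w^2/t^2" and "r = 3*(t-1)/(t+2)" and "y = 1 - x"
  have "w^2/t^2 \<ge> 0" by simp
  hence E: "E \<ge> 0" "E \<le> t - 2" using e w unfolding E_def eps_def by linarith+
  have r2: "2 - r = (7-t)/(t+2)" unfolding r_def using t by (simp add: field_simps)
  have "(5*t+1)/(t+2) = r + 2" unfolding r_def using t by (simp add: field_simps)
  hence "(5*t+1)*E/(t+2) = (r+2)*E" by (metis times_divide_eq_left mult.commute)
  moreover have "3*(t-1)*E/(t+2) = r*E" unfolding r_def by simp
  ultimately have "GB t w x = (x-1)^2*(x+g+2*E) + (r+2)*E*(x-1) + r*E"
    unfolding GB_def E_def g_def by simp
  also have "\<dots> = g*y^2 + x*(y^2 - 2*E*y + r*E)" unfolding y_def by algebra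
  finally have G: "GB t w x = g*y^2 + x*(y^2 - 2*E*y + r*E)" .
  have g: "g \<ge> 0" unfolding g_def by simp
  have y: "y \<ge> 0" "y \<le> 1" unfolding y_def using x False by auto
  \<comment> \<open>A quadratic in y on [0,1], with E \<le> t - 2. If E \<le> r, its minimum E(r-E)
    is nonnegative. Otherwise r < t - 2 forces t \<ge> 5/2, the point where r reaches 1; so E \<ge>
    1, the quadratic decreases on [0,1], and its value 1 - (2-r)E at y = 1 decides.\<close>
  have "y^2 - 2*E*y + r*E \<ge> 0"
  proof (cases "E \<le> r")
    case True
    have "y^2 - 2*E*y + r*E = (y-E)^2 + E*(r-E)" by algebra
    thus ?thesis using True E by simp
  next
    case F: False
    hence "r < t - 2" using E by simp
    hence "3*(t-1) < (t-2)*(t+2)" unfolding r_def using t by (simp add: divide_less_eq)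
    hence "t*t > 3*t + 1" by (simp add: algebra_simps)
    have "t \<ge> 5/2"
    proof (rule ccontr)
      assume "\<not> t \<ge> 5/2"
      hence "t*t \<le> 5/2*t" using t by (intro mult_right_mono) auto
      thus False using \<open>t*t > 3*t + 1\<close> t by linarith
    qed
    hence "r \<ge> 1" unfolding r_def by (simp add: le_divide_eq)
    hence E1: "E \<ge> 1" using F by simp
    have "(2-r)*E \<le> 1"
    proof (cases "t \<ge> 7")
      case True
      hence "(2-r)*E \<le> 0" unfolding r2 using E by (intro mult_nonpos_nonneg divide_nonpos_pos) auto
      thus ?thesis by simp
    next
      case F7: False
      have "(7-t)*E \<le> (7-t)*(t-2)" using E F7 by (intro mult_left_mono) auto
      also have "\<dots> \<le> t + 2" using zero_le_power2[of "t-4"] by (simp add: power2_eq_square algebra_simps)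
      finally show ?thesis unfolding r2 using t by (simp add: field_simps)
    qed
    moreover have "(1-y)*(2*E-1-y) \<ge> 0" using E1 y by simp
    moreover have "y^2 - 2*E*y + r*E = (1-y)*(2*E-1-y) + (1 - (2-r)*E)" by algebra
    ultimately show ?thesis by linarith
  qed
  thus ?thesis unfolding G using g x by simp
qed

lemma muR_ge_2: assumes "t \<ge> 2" shows "muR t \<ge> 2"
proof -
  have "t = sqrt (t^2)" using assms by simp
  also have "\<dots> \<le> sqrt ((t-1)*(t+2))"
    using assms by (intro real_sqrt_le_mono) (simp add: power2_eq_square algebra_simps)
  finally have "t*t \<le> t * sqrt ((t-1)*(t+2))" using assms by (intro mult_left_mono) auto
  thus ?thesis unfolding muR_def by (simp add: power2_eq_square)
qed

text \<open>Origin of \<open>muR\<close>: completing the square gives t^2 eps = t^2 (t-1)(t+2) -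
  (w+t^2)^2, whose larger root in w is \<open>muR t - 2\<close>.\<close>

lemma eps_nonneg_iff:
  assumes "t \<ge> 2" "w \<ge> 0"
  shows "eps t w \<ge> 0 \<longleftrightarrow> w \<le> muR t - 2"
proof -
  have sq: "(t * sqrt ((t-1)*(t+2)))^2 = t^2*((t-1)*(t+2))"
    using assms by (simp add: power_mult_distrib)
  have "t^2 * eps t w = t^2*((t-1)*(t+2)) - (w+t^2)^2"
    unfolding eps_def using assms by (simp add: field_simps power2_eq_square)
  hence "eps t w \<ge> 0 \<longleftrightarrow> (w+t^2)^2 \<le> (t * sqrt ((t-1)*(t+2)))^2"
    unfolding sq using assms zero_le_mult_iff[of "t^2" "eps t w"] by auto
  also have "\<dots> \<longleftrightarrow> w+t^2 \<le> t * sqrt ((t-1)*(t+2))"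
    using assms by (intro power2_le_iff_abs_le[THEN trans]) auto
  finally show ?thesis unfolding muR_def by auto
qed

text \<open>\<open>muB t\<close> is the smaller root of u + 1/u = \<open>muR t\<close>; the larger
  root is its inverse, and u lies between the two.\<close>

lemma omega_bounds:
  assumes "t \<ge> 2" "muB t \<le> u" "u \<le> 1"
  shows "omega u \<ge> 0" "omega u \<le> muR t - 2"
proof -
  define R S where "R = muR t" and "S = sqrt (R^2 - 4)"
  have R: "R \<ge> 2" unfolding R_def using muR_ge_2[OF assms(1)] .
  hence "R^2 \<ge> 2^2" by (intro power_mono) auto
  hence S: "S \<ge> 0" "S^2 = R^2 - 4" unfolding S_def by auto
  have "S^2 < R^2" using S by linarith
  moreover have "0 \<le> R" using R by simp
  ultimately have "S < R" by (rule power2_less_imp_less)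
  moreover have B: "(R - S)/2 \<le> u" using assms(2) unfolding muB_def R_def S_def .
  ultimately have u: "u > 0" by simp
  have "(u - 1)^2 / u \<ge> 0" using u by simp
  thus "omega u \<ge> 0" unfolding omega_def using u by (simp add: field_simps power2_eq_square)
  have "(2*u - R + S)*(R + S - 2*u) \<ge> 0" using B assms(3) R S(1) by (intro mult_nonneg_nonneg) auto
  moreover have "(2*u - R + S)*(R + S - 2*u) = 4*(R*u - u^2 - 1)" using S(2) by algebra
  ultimately have "u^2 + 1 \<le> R*u" by simp
  thus "omega u \<le> muR t - 2" unfolding omega_def R_def[symmetric]
    using u by (simp add: field_simps power2_eq_square)
qed

lemma omega_surj:
  assumes "t \<ge> 2" "w \<ge> 0" "w \<le> muR t - 2"
  obtains u where "muB t \<le> u" "u \<le> 1" "omega u = w"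
proof -
  define m S u where "m = w + 2" and "S = sqrt (m^2 - 4)" and "u = (m - S)/2"
  define R T where "R = muR t" and "T = sqrt (R^2 - 4)"
  have m: "m \<ge> 2" "m \<le> R" unfolding m_def R_def using assms by auto
  hence "m^2 \<ge> 2^2" by (intro power_mono) auto
  moreover have mR: "m^2 \<le> R^2" using m by (intro power_mono) auto
  ultimately have S: "S \<ge> 0" "S^2 = m^2 - 4" and T: "T \<ge> 0" "T^2 = R^2 - 4"
    unfolding S_def T_def by auto
  have ST: "S \<le> T" unfolding S_def T_def using mR by simp
  \<comment> \<open>Rationalising turns (m-S)/2 into 2/(m+S), which visibly decreases in m; thus w
    \<le> \<open>muR t - 2\<close> becomes \<open>muB t\<close> \<le> u.\<close>
  have rat: "((a - b)/2) * (a + b) = (a^2 - b^2)/2" for a b :: real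
    by (simp add: power2_eq_square field_simps)
  have um: "u * (m + S) = 2" unfolding u_def rat S(2) by simp
  have pos: "m + S > 0" "R + T > 0" using m S(1) T(1) by auto
  have u: "u = 2/(m+S)" using um pos by (simp add: field_simps)
  have "((R - T)/2) * (R + T) = 2" unfolding rat T(2) by simp
  hence "(R - T)/2 = 2/(R+T)" using pos by (simp add: field_simps)
  also have "\<dots> \<le> u" unfolding u using pos ST m by (intro divide_left_mono) auto
  finally have "muB t \<le> u" unfolding muB_def R_def T_def .
  moreover have "u \<le> 1" unfolding u using m S(1) by (simp add: divide_le_eq)
  moreover have "omega u = w"
  proof -
    have "u > 0" unfolding u using pos by simp
    have "1/u = (m + S)/2" unfolding u using pos by simp
    thus ?thesis unfolding omega_def by (simp add: u_def m_def field_simps)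
  qed
  ultimately show ?thesis using that by blast
qed

subsection \<open>Double zeros\<close>

lemma Fp_one: "Fp c0 c1 c2 c3 c4 1 = 3*c4" and Fp_zero: "Fp c0 c1 c2 c3 c4 0 = 2*(c0+c1+c2)"
  unfolding Fp_def by simp_all

lemma Qp_nonnegI:
  assumes "c0 \<ge> 0" "3*c0+c1 \<ge> 0" "Fp c0 c1 c2 c3 c4 0 \<ge> 0" "w \<ge> 0"
  shows "Qp c0 c1 c2 w \<ge> 0"
  using assms unfolding Qp_def Fp_zero by simp

text \<open>The last property is 3F'(1) = 5F(1) expressed through the cofactor and divided by 1 - t;
  for t = 1 it would carry no information.\<close>

lemma Fp_double_zero_factor:
  assumes "Fp c0 c1 c2 c3 c4 t = 0" "Fp' c0 c1 c2 c3 c4 t = 0"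
  obtains b2 b1 b0 where
    "\<And>x. Fp c0 c1 c2 c3 c4 x = (x-t)^2*(c0*x^3+b2*x^2+b1*x+b0)"
    "\<And>x. Fp' c0 c1 c2 c3 c4 x = 2*(x-t)*(c0*x^3+b2*x^2+b1*x+b0) + (x-t)^2*(3*c0*x^2+2*b2*x+b1)"
    "b2 = 2*c1 + 2*t*c0"
    "t \<noteq> 1 \<Longrightarrow> 3*(1-t)*(3*c0+2*b2+b1) + (1+5*t)*(c0+b2+b1+b0) = 0"
proof -
  define b2 where "b2 = 2*c1 + 2*t*c0"
  define b1 where "b1 = 2*c2 + c3 + 2*t*b2 - t^2*c0"
  define b0 where "b0 = - 2*c0 - 4*c1 - 2*c2 - 2*c3 + 2*c4 + 2*t*b1 - t^2*b2"
  have F: "Fp c0 c1 c2 c3 c4 x = (x-t)^2*(c0*x^3+b2*x^2+b1*x+b0)" for x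
  proof -
    have "Fp c0 c1 c2 c3 c4 x = (x-t)^2*(c0*x^3+b2*x^2+b1*x+b0)
       + Fp' c0 c1 c2 c3 c4 t * (x-t) + Fp c0 c1 c2 c3 c4 t"
      unfolding Fp_def Fp'_def b0_def b1_def b2_def by algebra
    thus ?thesis using assms by simp
  qed
  have F': "Fp' c0 c1 c2 c3 c4 x =
      2*(x-t)*(c0*x^3+b2*x^2+b1*x+b0) + (x-t)^2*(3*c0*x^2+2*b2*x+b1)" for x
  proof -
    have "Fp' c0 c1 c2 c3 c4 x = 2*(x-t)*(c0*x^3+b2*x^2+b1*x+b0)
       + (x-t)^2*(3*c0*x^2+2*b2*x+b1) + Fp' c0 c1 c2 c3 c4 t"
      unfolding Fp_def Fp'_def b0_def b1_def b2_def by algebra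
    thus ?thesis using assms by simp
  qed
  have "3*(1-t)*(3*c0+2*b2+b1) + (1+5*t)*(c0+b2+b1+b0) = 0" if "t \<noteq> 1"
  proof -
    have "3 * Fp' c0 c1 c2 c3 c4 1 = 5 * Fp c0 c1 c2 c3 c4 1" unfolding Fp_def Fp'_def by simp
    hence "(1-t) * (3*(1-t)*(3*c0+2*b2+b1) + (1+5*t)*(c0+b2+b1+b0)) = 0"
      unfolding F F' by simp algebra
    thus ?thesis using that by simp
  qed
  thus ?thesis using that F F' b2_def by blast
qed

lemma cubic_double_zero:
  fixes b3 b2 b1 b0 s :: real
  assumes "b3*s^3+b2*s^2+b1*s+b0 = 0" "3*b3*s^2+2*b2*s+b1 = 0"
  shows "b3*x^3+b2*x^2+b1*x+b0 = (x-s)^2*(b3*x+(b2+2*s*b3))"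
    and "3*b3*x^2+2*b2*x+b1 = 2*(x-s)*(b3*x+(b2+2*s*b3)) + (x-s)^2*b3"
proof -
  have "b3*x^3+b2*x^2+b1*x+b0 = (x-s)^2*(b3*x+(b2+2*s*b3)) + (3*b3*s^2+2*b2*s+b1)*(x-s)
      + (b3*s^3+b2*s^2+b1*s+b0)" by algebra
  thus "b3*x^3+b2*x^2+b1*x+b0 = (x-s)^2*(b3*x+(b2+2*s*b3))" using assms by simp
  have "3*b3*x^2+2*b2*x+b1 = 2*(x-s)*(b3*x+(b2+2*s*b3)) + (x-s)^2*b3 + (3*b3*s^2+2*b2*s+b1)"
    by algebra
  thus "3*b3*x^2+2*b2*x+b1 = 2*(x-s)*(b3*x+(b2+2*s*b3)) + (x-s)^2*b3" using assms by simp
qed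

lemma Fp_two_double_zeros:
  assumes z: "Fp c0 c1 c2 c3 c4 t = 0" "Fp' c0 c1 c2 c3 c4 t = 0"
      "Fp c0 c1 c2 c3 c4 s = 0" "Fp' c0 c1 c2 c3 c4 s = 0"
    and ne: "t \<noteq> s" "t \<noteq> 1" "s \<noteq> 1"
  obtains e where "\<And>x. Fp c0 c1 c2 c3 c4 x = (x-t)^2*(x-s)^2*(c0*x+e)"
    "6*(1-s)*(c0+e) + 6*(1-t)*(c0+e) + 3*(1-t)*(1-s)*c0 = 5*(1-t)*(1-s)*(c0+e)"
proof -
  obtain b2 b1 b0 where
    F: "\<And>x. Fp c0 c1 c2 c3 c4 x = (x-t)^2*(c0*x^3+b2*x^2+b1*x+b0)"
    and F': "\<And>x. Fp' c0 c1 c2 c3 c4 x = 2*(x-t)*(c0*x^3+b2*x^2+b1*x+b0) + (x-t)^2*(3*c0*x^2+2*b2*x+b1)"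
    and rel: "t \<noteq> 1 \<Longrightarrow> 3*(1-t)*(3*c0+2*b2+b1) + (1+5*t)*(c0+b2+b1+b0) = 0"
    using Fp_double_zero_factor[OF z(1,2)] by metis
  have G: "c0*s^3+b2*s^2+b1*s+b0 = 0" using z(3) ne(1) unfolding F by simp
  have G': "3*c0*s^2+2*b2*s+b1 = 0" using z(4) ne(1) unfolding F' G by simp
  define e where "e = b2+2*s*c0"
  note c = cubic_double_zero[OF G G', folded e_def]
  have "Fp c0 c1 c2 c3 c4 x = (x-t)^2*(x-s)^2*(c0*x+e)" for x
    unfolding F c by (simp only: mult.assoc)
  moreover have "6*(1-s)*(c0+e) + 6*(1-t)*(c0+e) + 3*(1-t)*(1-s)*c0 = 5*(1-t)*(1-s)*(c0+e)"
  proof -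
    have "3*c0+2*b2+b1 = 2*(1-s)*(c0+e) + (1-s)^2*c0" "c0+b2+b1+b0 = (1-s)^2*(c0+e)"
      using c(2)[of 1] c(1)[of 1] by simp_all
    hence "3*(1-t)*(2*(1-s)*(c0+e) + (1-s)^2*c0) + (1+5*t)*((1-s)^2*(c0+e)) = 0"
      using rel[OF ne(2)] by simp
    moreover have "3*(1-t)*(2*(1-s)*(c0+e) + (1-s)^2*c0) + (1+5*t)*((1-s)^2*(c0+e)) =
      (1-s)*(6*(1-s)*(c0+e) + 6*(1-t)*(c0+e) + 3*(1-t)*(1-s)*c0 - 5*(1-t)*(1-s)*(c0+e))"
      by algebra
    ultimately show ?thesis using ne(3) by simp
  qed
  ultimately show ?thesis using that by blast
qed

lemma dominated_Fp_double_zero: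
  assumes "Fp c0 c1 c2 c3 c4 t = 0" "Fp' c0 c1 c2 c3 c4 t = 0" "t \<ge> 0"
    and "nonneg_coeffs d0 d1 d2 d3 d4"
    and "\<And>x. x \<ge> 0 \<Longrightarrow> Fp d0 d1 d2 d3 d4 x \<le> Fp c0 c1 c2 c3 c4 x"
  shows "Fp d0 d1 d2 d3 d4 t = 0" "Fp' d0 d1 d2 d3 d4 t = 0"
proof -
  have "(Fp c0 c1 c2 c3 c4 has_real_derivative 0) (at t)" using DERIV_Fp assms(2) by metis
  from dominated_double_zero[OF this assms(1) DERIV_Fp _ assms(5,3)]
  show "Fp d0 d1 d2 d3 d4 t = 0" "Fp' d0 d1 d2 d3 d4 t = 0"
    using assms(4) unfolding nonneg_coeffs_def by blast+
qed

lemma Fp'_zero_of_square_factor: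
  assumes F: "\<And>x. Fp c0 c1 c2 c3 c4 x = (x-t)^2 * g x" and g: "(g has_real_derivative D) (at t)"
  shows "Fp' c0 c1 c2 c3 c4 t = 0"
proof -
  have "((\<lambda>x. (x-t)^2 * g x) has_real_derivative 0) (at t)"
    by (rule derivative_eq_intros g refl | simp)+
  moreover have "Fp c0 c1 c2 c3 c4 = (\<lambda>x. (x-t)^2 * g x)" using F by blast
  ultimately have "(Fp c0 c1 c2 c3 c4 has_real_derivative 0) (at t)" by simp
  thus ?thesis using DERIV_unique[OF DERIV_Fp] by blast
qed

text \<open>A summand inherits both double zeros, so it is (x-t)^2 (x-s)^2 (d0 x + e). The relation
  at 1 is a linear equation between d0 and d0 + e in which d0 has the nonzero coefficient M, so the
  ratio of d0 to e is forced.\<close>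

lemma extremal_two_double_zeros:
  assumes N: "nonneg_coeffs c0 c1 c2 c3 c4"
    and F: "\<And>x. Fp c0 c1 c2 c3 c4 x = (x-t)^2*(x-s)^2*(c0*x+k)"
    and nz: "c0 + k \<noteq> 0" and ts: "t \<ge> 0" "s \<ge> 0" "t \<noteq> s" "t \<noteq> 1" "s \<noteq> 1"
  shows "extremal Ps35 (comb c0 c1 c2 c3 c4)"
proof (rule extremal_combI[OF N])
  have F1: "Fp c0 c1 c2 c3 c4 1 \<noteq> 0" unfolding F using nz ts by simp
  thus "c0 \<noteq> 0 \<or> c1 \<noteq> 0 \<or> c2 \<noteq> 0 \<or> c3 \<noteq> 0 \<or> c4 \<noteq> 0" by (auto simp: Fp_def)
  have Ft: "Fp c0 c1 c2 c3 c4 t = 0" and Fs: "Fp c0 c1 c2 c3 c4 s = 0" unfolding F by simp_all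
  have Ft': "Fp' c0 c1 c2 c3 c4 t = 0"
    by (rule Fp'_zero_of_square_factor[where g = "\<lambda>x. (x-s)^2*(c0*x+k)"])
      (auto simp: F intro!: derivative_eq_intros)
  have Fs': "Fp' c0 c1 c2 c3 c4 s = 0"
    by (rule Fp'_zero_of_square_factor[where g = "\<lambda>x. (x-t)^2*(c0*x+k)"])
      (auto simp: F intro!: derivative_eq_intros)
  obtain k' where k': "\<And>x. Fp c0 c1 c2 c3 c4 x = (x-t)^2*(x-s)^2*(c0*x+k')"
    "6*(1-s)*(c0+k') + 6*(1-t)*(c0+k') + 3*(1-t)*(1-s)*c0 = 5*(1-t)*(1-s)*(c0+k')"
    using Fp_two_double_zeros[OF Ft Ft' Fs Fs' ts(3-5)] by metis
  have "k' = k" using k'(1)[of 1] F[of 1] ts by simp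
  fix d0 d1 d2 d3 d4
  assume d: "nonneg_coeffs d0 d1 d2 d3 d4"
    and dc: "\<And>x. x \<ge> 0 \<Longrightarrow> Fp d0 d1 d2 d3 d4 x \<le> Fp c0 c1 c2 c3 c4 x"
  note dt = dominated_Fp_double_zero[OF Ft Ft' ts(1) d dc]
  note ds = dominated_Fp_double_zero[OF Fs Fs' ts(2) d dc]
  obtain e where e: "\<And>x. Fp d0 d1 d2 d3 d4 x = (x-t)^2*(x-s)^2*(d0*x+e)"
    "6*(1-s)*(d0+e) + 6*(1-t)*(d0+e) + 3*(1-t)*(1-s)*d0 = 5*(1-t)*(1-s)*(d0+e)"
    using Fp_two_double_zeros[OF dt ds ts(3-5)] by metis
  define B M where "B = 6*(1-s) + 6*(1-t) - 5*(1-t)*(1-s)" and "M = 3*(1-t)*(1-s)"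
  have M: "M \<noteq> 0" unfolding M_def using ts by simp
  have "B*(c0+k) + M*c0 = 0" using k'(2) unfolding \<open>k' = k\<close> B_def M_def by algebra
  hence c0: "c0 = - (B/M)*(c0+k)" using M by (simp add: field_simps)
  have "B*(d0+e) + M*d0 = 0" using e(2) unfolding B_def M_def by algebra
  hence d0: "d0 = - (B/M)*(d0+e)" using M by (simp add: field_simps)
  define r where "r = (d0+e)/(c0+k)"
  have r: "d0 + e = r*(c0+k)" unfolding r_def using nz by simp
  hence r0: "d0 = r*c0" using c0 d0 by (metis mult.left_commute)
  hence re: "e = r*k" using r by (simp add: algebra_simps)
  have "Fp d0 d1 d2 d3 d4 x = r * Fp c0 c1 c2 c3 c4 x" for x
  proof -
    have "d0*x+e = r*(c0*x+k)" unfolding r0 re by (simp add: algebra_simps)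
    thus ?thesis unfolding e(1) F by simp
  qed
  thus "\<exists>r. d0 = r*c0 \<and> d1 = r*c1 \<and> d2 = r*c2 \<and> d3 = r*c3 \<and> d4 = r*c4"
    using Fp_eq_coeffs by blast
qed

text \<open>Cancelling (x-s)^2 or x from an inequality loses the point s or 0; continuity recovers
  both.\<close>

lemma nonneg_off_point:
  fixes p :: "real \<Rightarrow> real"
  assumes c: "\<And>x. isCont p x" and nn: "\<And>x. x > 0 \<Longrightarrow> x \<noteq> s \<Longrightarrow> p x \<ge> 0" and x: "x \<ge> 0"
  shows "p x \<ge> 0"
proof -
  have "(p \<longlongrightarrow> p x) (at_right x)" using c[of x] unfolding isCont_def by (rule filterlim_mono) (auto simp: at_le)
  moreover have "\<forall>\<^sub>F y in at_right x. p y \<ge> 0"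
  proof (cases "x < s")
    case True thus ?thesis unfolding eventually_at_right_field using x nn by (intro exI[of _ s]) auto
  next
    case False thus ?thesis unfolding eventually_at_right_field using x nn by (intro exI[of _ "x+1"]) auto
  qed
  ultimately show ?thesis using tendsto_lowerbound by fastforce
qed

text \<open>The squeezed quadratic has a double zero at t, so it is a(x-t)^2. The point 1 is
  excepted because in families C and D the bounds arise by cancelling (x-1)^2.\<close>

lemma dominated_square:
  fixes a b c :: real
  assumes "t \<ge> 0" and bd: "\<And>x. x > 0 \<Longrightarrow> x \<noteq> 1 \<Longrightarrow> 0 \<le> a*x^2+b*x+c"
    "\<And>x. x > 0 \<Longrightarrow> x \<noteq> 1 \<Longrightarrow> a*x^2+b*x+c \<le> m*(x-t)^2"
  shows "b = -2*a*t \<and> c = a*t^2"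
proof -
  have l: "0 \<le> a*x^2+b*x+c" if "x \<ge> 0" for x
    by (rule nonneg_off_point[where s = 1 and p = "\<lambda>x. a*x^2+b*x+c"]) (use bd that in auto)
  have u: "a*x^2+b*x+c \<le> m*(x-t)^2" if "x \<ge> 0" for x
  proof -
    have "0 \<le> m*(x-t)^2 - (a*x^2+b*x+c)"
      by (rule nonneg_off_point[where s = 1 and p = "\<lambda>x. m*(x-t)^2 - (a*x^2+b*x+c)"]) (use bd that in auto)
    thus ?thesis by simp
  qed
  have f: "((\<lambda>x. m*(x-t)^2) has_real_derivative 0) (at t)" by (auto intro!: derivative_eq_intros)
  have g: "((\<lambda>x. a*x^2+b*x+c) has_real_derivative (2*a*t+b)) (at t)" by (auto intro!: derivative_eq_intros)
  have "a*t^2+b*t+c = 0" "2*a*t+b = 0"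
    using dominated_double_zero[OF f _ g l u assms(1)] by simp_all
  thus ?thesis by algebra
qed

lemma affine_bounded:
  fixes a b m :: real
  assumes "\<And>w. w \<ge> 0 \<Longrightarrow> 0 \<le> a*w+b" "\<And>w. w \<ge> 0 \<Longrightarrow> a*w+b \<le> m"
  shows "a = 0"
proof (rule ccontr)
  assume a: "a \<noteq> 0"
  define w where "w = (\<bar>b\<bar> + \<bar>m\<bar> + 1)/\<bar>a\<bar>"
  have w: "w \<ge> 0" "\<bar>a\<bar>*w = \<bar>b\<bar> + \<bar>m\<bar> + 1" unfolding w_def using a by auto
  show False
  proof (cases "a > 0")
    case True thus ?thesis using assms(2)[OF w(1)] w(2) by simp
  next
    case False
    hence "a*w = - (\<bar>a\<bar>*w)" by simp
    thus ?thesis using assms(1)[OF w(1)] w(2) by linarith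
  qed
qed

lemma dominated_leading:
  assumes "nonneg_coeffs d0 d1 d2 d3 d4" "\<And>w. w \<ge> 0 \<Longrightarrow> Qp d0 d1 d2 w \<le> Qp 0 c1 c2 w"
  shows "d0 = 0"
proof -
  have "d0 \<ge> 0" using assms(1) Qp_nonneg_leading unfolding nonneg_coeffs_def by blast
  moreover have "0 - 1*d0 \<ge> 0"
    by (rule Qp_nonneg_leading[of _ "c1-1*d1" "c2-1*d2"]) (use assms(2) in \<open>simp only: Fp_linear, simp\<close>)
  ultimately show ?thesis by simp
qed

subsection \<open>The listed forms are extremal\<close>

lemma nonneg_coeffs_eC:
  assumes "0 \<le> t" "t \<le> 2"
  shows "nonneg_coeffs 1 (-(t+1)) t ((t+1)^2) 0"
  \<comment> \<open>Q(w) = w^2 + (2-t)w, which is the source of the bound t \<le> 2.\<close>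
  unfolding nonneg_coeffs_def Fp_eC using assms by (simp add: Qp_def)

lemma extremal_eC:
  assumes "0 \<le> t" "t \<le> 2"
  shows "extremal Ps35 (eC t)"
  unfolding eC_def
proof (rule extremal_combI[OF nonneg_coeffs_eC[OF assms]])
  fix d0 d1 d2 d3 d4
  assume d: "nonneg_coeffs d0 d1 d2 d3 d4"
    and dc: "\<And>x. x \<ge> 0 \<Longrightarrow> Fp d0 d1 d2 d3 d4 x \<le> Fp 1 (-(t+1)) t ((t+1)^2) 0 x"
  have d': "Fp d0 d1 d2 d3 d4 x \<ge> 0" if "x \<ge> 0" for x using d that unfolding nonneg_coeffs_def by blast
  have d4: "d4 = 0" using dc[of 1] d'[of 1] unfolding Fp_eC Fp_one by simp
  have d2: "d2 = - d0 - d1" using dc[of 0] d'[of 0] unfolding Fp_eC Fp_zero by simp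
  have F: "Fp d0 d1 d2 d3 d4 x = x*(x-1)^2*(d0*x^2+(2*d0+2*d1)*x+(d0+2*d1+d3))" for x
    unfolding Fp_def d4 d2 by algebra
  have b: "0 \<le> d0*x^2+(2*d0+2*d1)*x+(d0+2*d1+d3)" "d0*x^2+(2*d0+2*d1)*x+(d0+2*d1+d3) \<le> 1*(x-t)^2"
    if "x > 0" "x \<noteq> 1" for x
  proof -
    have p: "x*(x-1)^2 > 0" using that by simp
    show "0 \<le> d0*x^2+(2*d0+2*d1)*x+(d0+2*d1+d3)"
      using d'[of x] that p unfolding F by (simp add: zero_le_mult_iff)
    have "x*(x-1)^2*(d0*x^2+(2*d0+2*d1)*x+(d0+2*d1+d3)) \<le> x*(x-1)^2*(x-t)^2"
      using dc[of x] that unfolding F Fp_eC by simp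
    thus "d0*x^2+(2*d0+2*d1)*x+(d0+2*d1+d3) \<le> 1*(x-t)^2"
      using mult_le_cancel_left_pos[OF p] by simp
  qed
  have "2*d0+2*d1 = -2*d0*t \<and> d0+2*d1+d3 = d0*t^2" using dominated_square[OF assms(1) b] .
  hence "d1 = d0 * (-(t+1))" "d3 = d0*(t+1)^2" by algebra+
  moreover from this have "d2 = d0*t" unfolding d2 by algebra
  ultimately show "\<exists>r. d0 = r*1 \<and> d1 = r*(-(t+1)) \<and> d2 = r*t \<and> d3 = r*(t+1)^2 \<and> d4 = r*0"
    using d4 by (intro exI[of _ d0]) simp
qed simp

lemma nonneg_coeffs_eD: "nonneg_coeffs 0 1 (t^2-1) (-2*(t+1)^2) 0"
  unfolding nonneg_coeffs_def Fp_eD by (simp add: Qp_def)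

lemma Fp_square_factor:
  assumes "d0 = 0" "d4 = 0"
  shows "Fp d0 d1 d2 d3 d4 x = (x-1)^2*(2*d1*x^2+(4*d1+2*d2+d3)*x+(2*d1+2*d2))"
  unfolding Fp_def assms by algebra

lemma extremal_eD:
  assumes "0 \<le> t"
  shows "extremal Ps35 (eD t)"
  unfolding eD_def
proof (rule extremal_combI[OF nonneg_coeffs_eD])
  fix d0 d1 d2 d3 d4
  assume d: "nonneg_coeffs d0 d1 d2 d3 d4"
    and dc: "\<And>x. x \<ge> 0 \<Longrightarrow> Fp d0 d1 d2 d3 d4 x \<le> Fp 0 1 (t^2-1) (-2*(t+1)^2) 0 x"
    and dq: "\<And>x. x \<ge> 0 \<Longrightarrow> Qp d0 d1 d2 x \<le> Qp 0 1 (t^2-1) x"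
  have d': "Fp d0 d1 d2 d3 d4 x \<ge> 0" if "x \<ge> 0" for x using d that unfolding nonneg_coeffs_def by blast
  have d0: "d0 = 0" using dominated_leading[OF d dq] .
  have d4: "d4 = 0" using dc[of 1] d'[of 1] unfolding Fp_eD Fp_one by simp
  note F = Fp_square_factor[OF d0 d4]
  have b: "0 \<le> 2*d1*x^2+(4*d1+2*d2+d3)*x+(2*d1+2*d2)"
    "2*d1*x^2+(4*d1+2*d2+d3)*x+(2*d1+2*d2) \<le> 2*(x-t)^2"
    if "x > 0" "x \<noteq> 1" for x
  proof -
    have p: "(x-1)^2 > 0" using that by simp
    show "0 \<le> 2*d1*x^2+(4*d1+2*d2+d3)*x+(2*d1+2*d2)"
      using d'[of x] that p unfolding F by (simp add: zero_le_mult_iff)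
    have "(x-1)^2*(2*d1*x^2+(4*d1+2*d2+d3)*x+(2*d1+2*d2)) \<le> (x-1)^2*(2*(x-t)^2)"
      using dc[of x] that unfolding F Fp_eD by (simp add: mult_ac)
    thus "2*d1*x^2+(4*d1+2*d2+d3)*x+(2*d1+2*d2) \<le> 2*(x-t)^2"
      using mult_le_cancel_left_pos[OF p] by simp
  qed
  have "4*d1+2*d2+d3 = -2*(2*d1)*t \<and> 2*d1+2*d2 = 2*d1*t^2" using dominated_square[OF assms(1) b] .
  hence "d2 = d1 * (t^2-1)" "d3 = d1*(-2*(t+1)^2)" by algebra+
  thus "\<exists>r. d0 = r*0 \<and> d1 = r*1 \<and> d2 = r*(t^2-1) \<and> d3 = r*(-2*(t+1)^2) \<and> d4 = r*0"
    using d4 d0 by (intro exI[of _ d1]) simp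
qed simp

lemma Fp_eD_inf: "Fp 0 0 1 (-2) 0 x = 2*(x-1)^2"
  unfolding Fp_def by algebra

lemma nonneg_coeffs_eD_inf: "nonneg_coeffs 0 0 1 (-2) 0"
  unfolding nonneg_coeffs_def Fp_eD_inf by (simp add: Qp_def)

lemma extremal_eD_inf: "extremal Ps35 eD_inf"
  unfolding eD_inf_def
proof (rule extremal_combI[OF nonneg_coeffs_eD_inf])
  fix d0 d1 d2 d3 d4
  assume d: "nonneg_coeffs d0 d1 d2 d3 d4"
    and dc: "\<And>x. x \<ge> 0 \<Longrightarrow> Fp d0 d1 d2 d3 d4 x \<le> Fp 0 0 1 (-2) 0 x"
    and dq: "\<And>x. x \<ge> 0 \<Longrightarrow> Qp d0 d1 d2 x \<le> Qp 0 0 1 x"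
  have d': "Fp d0 d1 d2 d3 d4 x \<ge> 0" if "x \<ge> 0" for x using d that unfolding nonneg_coeffs_def by blast
  have d0: "d0 = 0" using dominated_leading[OF d dq] .
  have d4: "d4 = 0" using dc[of 1] d'[of 1] unfolding Fp_eD_inf Fp_one by simp
  have d1: "d1 = 0"
  proof (rule affine_bounded)
    show "0 \<le> d1*w + (d1+d2)" if "w \<ge> 0" for w
      using d that unfolding nonneg_coeffs_def Qp_def d0 by simp
    show "d1*w + (d1+d2) \<le> 1" if "w \<ge> 0" for w
      using dq[OF that] unfolding Qp_def d0 by simp
  qed
  have F: "Fp d0 d1 d2 d3 d4 x = (x-1)^2*((2*d2+d3)*x+2*d2)" for x
    using Fp_square_factor[OF d0 d4, of d1] d1 by simp
  have b: "0 \<le> (2*d2+d3)*x+2*d2" "(2*d2+d3)*x+2*d2 \<le> 2"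
    if "x > 0" "x \<noteq> 1" for x
  proof -
    have p: "(x-1)^2 > 0" using that by simp
    show "0 \<le> (2*d2+d3)*x+2*d2"
      using d'[of x] that p unfolding F by (simp add: zero_le_mult_iff)
    have "(x-1)^2*((2*d2+d3)*x+2*d2) \<le> (x-1)^2*2"
      using dc[of x] that unfolding F Fp_eD_inf by (simp add: mult_ac)
    thus "(2*d2+d3)*x+2*d2 \<le> 2"
      using mult_le_cancel_left_pos[OF p] by simp
  qed
  have "2*d2+d3 = 0"
  proof (rule affine_bounded)
    show "0 \<le> (2*d2+d3)*w+(2*(2*d2+d3)+2*d2)" if "w \<ge> 0" for w
      \<comment> \<open>The shift by 2 keeps the argument away from 0 and 1, where \<open>b\<close>
        gives nothing.\<close>
      using b(1)[of "w+2"] that by (simp add: algebra_simps)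
    show "(2*d2+d3)*w+(2*(2*d2+d3)+2*d2) \<le> 2" if "w \<ge> 0" for w
      using b(2)[of "w+2"] that by (simp add: algebra_simps)
  qed
  thus "\<exists>r. d0 = r*0 \<and> d1 = r*0 \<and> d2 = r*1 \<and> d3 = r*(-2) \<and> d4 = r*0"
    using d4 d0 d1 by (intro exI[of _ d2]) simp
qed simp

text \<open>The simple root (7-t)/(2(t+2)) of F must not be positive, which is t \<ge> 7.\<close>

lemma nonneg_coeffs_eE:
  assumes "t \<ge> 7"
  shows "nonneg_coeffs 0 1 (-1) (- (4*t^2 + 5*t + 3) / (t+2)) ((t-1)^3 / (t+2))"
proof -
  have t: "t \<ge> 0" using assms by simp
  show ?thesis unfolding nonneg_coeffs_def Fp_eE[OF t] using assms by (simp add: Qp_def)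
qed

text \<open>The degree of Q forces d0 = 0. The double zero at t and the zero at 0 leave the cofactor
  two coefficients, and the relation at 1 fixes their ratio.\<close>

lemma extremal_eE:
  assumes t: "t \<ge> 7"
  shows "extremal Ps35 (eE t)"
  unfolding eE_def
proof (rule extremal_combI[OF nonneg_coeffs_eE[OF t]])
  let ?c3 = "- (4*t^2 + 5*t + 3) / (t+2)" and ?c4 = "(t-1)^3 / (t+2)"
  have t0: "t \<ge> 0" using t by simp
  note Fc = Fp_eE[OF t0]
  fix d0 d1 d2 d3 d4
  assume d: "nonneg_coeffs d0 d1 d2 d3 d4"
    and dc: "\<And>x. x \<ge> 0 \<Longrightarrow> Fp d0 d1 d2 d3 d4 x \<le> Fp 0 1 (-1) ?c3 ?c4 x"
    and dq: "\<And>x. x \<ge> 0 \<Longrightarrow> Qp d0 d1 d2 x \<le> Qp 0 1 (-1) x"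
  have d': "Fp d0 d1 d2 d3 d4 x \<ge> 0" if "x \<ge> 0" for x using d that unfolding nonneg_coeffs_def by blast
  have d0: "d0 = 0" using dominated_leading[OF d dq] .
  have z: "Fp 0 1 (-1) ?c3 ?c4 t = 0" unfolding Fc by simp
  have z': "Fp' 0 1 (-1) ?c3 ?c4 t = 0"
    by (rule Fp'_zero_of_square_factor[where g = "\<lambda>x. x*(2*x+(t-7)/(t+2))"])
      (simp only: Fc, auto intro!: derivative_eq_intros)
  obtain b2 b1 b0 where F: "\<And>x. Fp d0 d1 d2 d3 d4 x = (x-t)^2*(d0*x^3+b2*x^2+b1*x+b0)"
    and b2: "b2 = 2*d1 + 2*t*d0"
    and rel: "t \<noteq> 1 \<Longrightarrow> 3*(1-t)*(3*d0+2*b2+b1) + (1+5*t)*(d0+b2+b1+b0) = 0"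
    using Fp_double_zero_factor[OF dominated_Fp_double_zero[OF z z' t0 d dc]] by metis
  have "Fp d0 d1 d2 d3 d4 0 = 0" using dc[of 0] d'[of 0] unfolding Fc by simp
  hence b0: "b0 = 0" using t unfolding F by simp
  have b2': "b2 = 2*d1" using b2 d0 by simp
  have "(t+2)*b1 = (t-7)*d1" using rel t unfolding d0 b0 b2' by (simp add: algebra_simps)
  hence b1: "b1 = (t-7)/(t+2)*d1" using t by (simp add: field_simps)
  have "Fp d0 d1 d2 d3 d4 x = d1 * Fp 0 1 (-1) ?c3 ?c4 x" for x
  proof -
    have "0*x^3+2*d1*x^2+(t-7)/(t+2)*d1*x+0 = d1*(x*(2*x+(t-7)/(t+2)))"
      by (simp add: power2_eq_square ring_distribs)
    thus ?thesis unfolding F Fc unfolding d0 b0 b1 b2' by (simp only: mult.left_commute)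
  qed
  thus "\<exists>r. d0 = r*0 \<and> d1 = r*1 \<and> d2 = r*(-1) \<and> d3 = r*?c3 \<and> d4 = r*?c4"
    using Fp_eq_coeffs by blast
qed simp

lemma Fp_eE_inf: "Fp 0 0 0 0 1 x = x*(2*x+1)"
  unfolding Fp_def by algebra

lemma nonneg_coeffs_eE_inf: "nonneg_coeffs 0 0 0 0 1"
  unfolding nonneg_coeffs_def Fp_eE_inf by (simp add: Qp_def)

lemma Fp_s3: "Fp 0 0 0 1 0 x = x*(x-1)^2"
  unfolding Fp_def by algebra

lemma nonneg_coeffs_s3: "nonneg_coeffs 0 0 0 1 0"
  unfolding nonneg_coeffs_def Fp_s3 by (simp add: Qp_def)

lemma s3_comb: "s3 = comb 0 0 0 1 0" unfolding comb_def by simp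

lemma dominated_Qp_zero:
  assumes d: "nonneg_coeffs d0 d1 d2 d3 d4" and dq: "\<And>x. x \<ge> 0 \<Longrightarrow> Qp d0 d1 d2 x \<le> Qp 0 0 0 x"
  shows "d0 = 0 \<and> d1 = 0 \<and> d2 = 0"
proof -
  have Q: "Qp d0 d1 d2 x = 0" if "x \<ge> 0" for x
    using d dq[OF that] that unfolding nonneg_coeffs_def by (simp add: Qp_def antisym)
  have d0: "d0 = 0" using dominated_leading[OF d dq] .
  show ?thesis using Q[of 0] Q[of 1] unfolding Qp_def d0 by simp
qed

lemma extremal_s3: "extremal Ps35 s3"
  unfolding s3_comb
proof (rule extremal_combI[OF nonneg_coeffs_s3])
  fix d0 d1 d2 d3 d4
  assume d: "nonneg_coeffs d0 d1 d2 d3 d4"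
    and dc: "\<And>x. x \<ge> 0 \<Longrightarrow> Fp d0 d1 d2 d3 d4 x \<le> Fp 0 0 0 1 0 x"
    and dq: "\<And>x. x \<ge> 0 \<Longrightarrow> Qp d0 d1 d2 x \<le> Qp 0 0 0 x"
  have "Fp d0 d1 d2 d3 d4 1 \<ge> 0" using d unfolding nonneg_coeffs_def by simp
  hence "d4 = 0" using dc[of 1] unfolding Fp_s3 Fp_one by simp
  thus "\<exists>r. d0 = r*0 \<and> d1 = r*0 \<and> d2 = r*0 \<and> d3 = r*1 \<and> d4 = r*0"
    using dominated_Qp_zero[OF d dq] by simp
qed simp

lemma extremal_eE_inf: "extremal Ps35 eE_inf"
  unfolding eE_inf_def
proof (rule extremal_combI[OF nonneg_coeffs_eE_inf])
  fix d0 d1 d2 d3 d4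
  assume d: "nonneg_coeffs d0 d1 d2 d3 d4"
    and dc: "\<And>x. x \<ge> 0 \<Longrightarrow> Fp d0 d1 d2 d3 d4 x \<le> Fp 0 0 0 0 1 x"
    and dq: "\<And>x. x \<ge> 0 \<Longrightarrow> Qp d0 d1 d2 x \<le> Qp 0 0 0 x"
  have dz: "d0 = 0" "d1 = 0" "d2 = 0" using dominated_Qp_zero[OF d dq] by auto
  have "d3 = 0"
  proof (rule antisym)
    \<comment> \<open>With x = w + 1 the positive factor x cancels. What remains has leading
      coefficient d3 but is squeezed between 0 and a linear function, so d3 is neither negative nor
      positive.\<close>
    have F: "Fp d0 d1 d2 d3 d4 (w+1) = (w+1)*(d3*w^2+2*d4*w+3*d4)" for w
      unfolding Fp_def dz by algebra
    have "Qp d3 (2*d4-3*d3) (d4+2*d3) w \<ge> 0" if "w \<ge> 0" for w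
    proof -
      have "(w+1)*(d3*w^2+2*d4*w+3*d4) \<ge> 0"
        unfolding F[symmetric] using d that unfolding nonneg_coeffs_def by simp
      hence "d3*w^2+2*d4*w+3*d4 \<ge> 0" using that by (simp add: zero_le_mult_iff)
      thus ?thesis unfolding Qp_def by (simp add: algebra_simps)
    qed
    thus "0 \<le> d3" by (rule Qp_nonneg_leading)
    have "Qp (-d3) (2*(1-d4)+3*d3) (1-d4-2*d3) w \<ge> 0" if "w \<ge> 0" for w
    proof -
      have "(w+1)*(d3*w^2+2*d4*w+3*d4) \<le> (w+1)*(2*w+3)"
        using dc[of "w+1"] that unfolding F Fp_eE_inf by (simp add: algebra_simps)
      hence "d3*w^2+2*d4*w+3*d4 \<le> 2*w+3" using that mult_le_cancel_left_pos[of "w+1"] by simp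
      thus ?thesis unfolding Qp_def by (simp add: algebra_simps)
    qed
    hence "0 \<le> - d3" by (rule Qp_nonneg_leading)
    thus "d3 \<le> 0" by simp
  qed
  thus "\<exists>r. d0 = r*0 \<and> d1 = r*0 \<and> d2 = r*0 \<and> d3 = r*0 \<and> d4 = r*1"
    using dz by simp
qed simp

section \<open>Family A: nonnegativity and extremality\<close>

lemma eA_quadratic_nonneg:
  fixes t u :: real
  assumes t: "0 \<le> t" and u: "u > 0" and uH: "u \<le> (t+2)*(7-t)"
  shows "u^2 - (t+2)*(5*t^2-14*t+6)*u + 9*(t-1)^2*(t+2)^2 \<ge> 0"
\<comment> \<open>The expression is the numerator of 3 + \<open>pA1 t u\<close>, the linear
  coefficient of Q. From t = 5/2 on, 7 - t \<le> 3(t-1) makes the bound on u effective; below 5/2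
  the expression dominates the square of u - 3(t+2)|t-1|.\<close>
proof (cases "t \<ge> 5/2")
  case True
  define U where "U = (t+2)*(7-t)"
  have U: "U > 0" "u \<le> U" using u uH unfolding U_def by auto
  hence t7: "7 - t > 0" unfolding U_def using t by (simp add: zero_less_mult_iff)
  have "(7-t)^2 \<le> (3*(t-1))^2" using True t7 by (intro power_mono) auto
  hence "(t+2)^2*(7-t)^2 \<le> (t+2)^2*(3*(t-1))^2" by (intro mult_left_mono) auto
  hence "U*U \<le> 9*(t-1)^2*(t+2)^2" unfolding U_def by (simp add: power2_eq_square algebra_simps)
  moreover have "u*U \<le> U*U" using U by (intro mult_right_mono) auto
  ultimately have "u*U \<le> 9*(t-1)^2*(t+2)^2" by linarith
  hence "(U-u)*(9*(t-1)^2*(t+2)^2 - u*U) \<ge> 0" using U by (intro mult_nonneg_nonneg) auto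
  moreover have "(t+2)^2*(t-4)^2*(5*t+1)*u \<ge> 0" using t u by simp
  \<comment> \<open>An expansion about the endpoint u = U, where the quadratic takes the value
    (t+2)^2 (t-4)^2 (5t+1).\<close>
  moreover have "(u^2 - (t+2)*(5*t^2-14*t+6)*u + 9*(t-1)^2*(t+2)^2) * U =
      (U-u)*(9*(t-1)^2*(t+2)^2 - u*U) + (t+2)^2*(t-4)^2*(5*t+1)*u"
    unfolding U_def by algebra
  ultimately have "(u^2 - (t+2)*(5*t^2-14*t+6)*u + 9*(t-1)^2*(t+2)^2) * U \<ge> 0" by linarith
  thus ?thesis using U(1) by (simp add: zero_le_mult_iff)
next
  case False
  have "5*t^2-14*t+6 \<le> 6*\<bar>t-1\<bar>"
  proof (cases "t \<le> 1")
    case True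
    hence "5*(t*t) \<le> 5*(1*t)" using t by (intro mult_left_mono mult_right_mono) auto
    thus ?thesis using True t by (simp add: power2_eq_square)
  next
    case F: False
    hence "(t-1)*(5/2-t) \<ge> 0" using False by simp
    moreover have "(t-1)*(5/2-t) = 7/2*t - t^2 - 5/2" by (simp add: power2_eq_square field_simps)
    ultimately have "t^2 \<le> 7/2*t - 5/2" by linarith
    thus ?thesis using F by (simp add: abs_if)
  qed
  hence "(t+2)*(5*t^2-14*t+6)*u \<le> (t+2)*(6*\<bar>t-1\<bar>)*u"
    using t u by (intro mult_left_mono mult_right_mono) auto
  moreover have "(u - 3*(t+2)*\<bar>t-1\<bar>)^2 = u^2 - (t+2)*(6*\<bar>t-1\<bar>)*u + 9*\<bar>t-1\<bar>^2*(t+2)^2" by algebra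
  ultimately show ?thesis using zero_le_power2[of "u - 3*(t+2)*\<bar>t-1\<bar>"] by simp
qed

text \<open>The two bounds in \<open>muA\<close> have separate meanings: u \<le>
  \<open>muH t\<close> places the second double zero at s \<ge> 0, and u \<le> \<open>muL t\<close>
  keeps the simple root -k from being positive. Q is nonnegative because all its coefficients
  are.\<close>

lemma nonneg_coeffs_eA:
  assumes t: "0 \<le> t" "t \<le> 7" and u: "u > 0" "u \<le> muA t"
  shows "nonneg_coeffs 1 (pA1 t u) (pA2 t u) (pA3 t u) (pA4 t u)" "sA t u \<ge> 0" "kA t u \<ge> 0"
proof -
  have uL: "u \<le> 9*(t-1)^2" and uH: "u \<le> (t+2)*(7-t)"
    using u(2) unfolding muA_def muL_def muH_def by simp_all
  show s: "sA t u \<ge> 0" unfolding sA_def using uH t by simp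
  show k: "kA t u \<ge> 0" unfolding kA_def using uL t u by simp
  note F = Fp_eA[OF t(1) u(1)]
  have F0: "Fp 1 (pA1 t u) (pA2 t u) (pA3 t u) (pA4 t u) x \<ge> 0" if "x \<ge> 0" for x
    unfolding F using that k by simp
  have "3 + pA1 t u = (u^2 - (t+2)*(5*t^2-14*t+6)*u + 9*(t-1)^2*(t+2)^2) / ((5*t+1)*(t+2)*u)"
  proof -
    have p: "(5*t+1)*(t+2)*u \<noteq> 0" using t u by simp
    have "3 + pA1 t u = (3*((5*t+1)*(t+2)*u) + (u^2 - (t+2)*(5*t^2+t+9)*u + 9*(t-1)^2*(t+2)^2))
        / ((5*t+1)*(t+2)*u)"
      unfolding pA1_def add_divide_distrib[of "3*((5*t+1)*(t+2)*u)"] nonzero_mult_div_cancel_right[OF p] ..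
    also have "3*((5*t+1)*(t+2)*u) + (u^2 - (t+2)*(5*t^2+t+9)*u + 9*(t-1)^2*(t+2)^2) =
        u^2 - (t+2)*(5*t^2-14*t+6)*u + 9*(t-1)^2*(t+2)^2" by algebra
    finally show ?thesis .
  qed
  moreover have "u^2 - (t+2)*(5*t^2-14*t+6)*u + 9*(t-1)^2*(t+2)^2 \<ge> 0"
    using eA_quadratic_nonneg[OF t(1) u(1) uH] .
  ultimately have "3 + pA1 t u \<ge> 0" using t u by simp
  thus "nonneg_coeffs 1 (pA1 t u) (pA2 t u) (pA3 t u) (pA4 t u)"
    unfolding nonneg_coeffs_def using F0 Qp_nonnegI[of 1 "pA1 t u" "pA2 t u" "pA3 t u" "pA4 t u"] by simp
qed

text \<open>The two double zeros lie strictly on opposite sides of 1, hence are distinct from each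
  other and from 1.\<close>

lemma extremal_eA_pos:
  assumes t: "0 \<le> t" "t \<le> 7" and u: "u > 0" "u \<le> muA t"
  shows "extremal Ps35 (eA t u)"
proof -
  note n = nonneg_coeffs_eA[OF assms]
  have uL: "u \<le> 9*(t-1)^2" using u(2) unfolding muA_def muL_def muH_def by simp
  have t1: "t \<noteq> 1" using uL u by auto
  have p: "(t+2)*(5*t+1) > 0" using t by simp
  hence s: "(1 - sA t u) * ((t+2)*(5*t+1)) = 6*(t-1)*(t+2) + u"
    unfolding sA_def by (simp add: field_simps)
  have st: "(t < 1 \<and> sA t u > 1) \<or> (t > 1 \<and> sA t u < 1)"
  proof (cases "t > 1")
    case True
    hence "6*(t-1)*(t+2) > 0" by simp
    hence "(1 - sA t u) * ((t+2)*(5*t+1)) > 0" unfolding s using u by linarith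
    thus ?thesis using p True by (simp add: zero_less_mult_iff)
  next
    case False
    hence lt: "1 - t > 0" using t1 by simp
    have "9*(t-1)^2 = 3*(1-t)*(3-3*t)" by algebra
    also have "\<dots> < 3*(1-t)*(2*(t+2))" using lt t by (intro mult_strict_left_mono) auto
    finally have "6*(t-1)*(t+2) + u < 0" using uL by (simp add: algebra_simps)
    hence "(1 - sA t u) * ((t+2)*(5*t+1)) < 0" unfolding s .
    hence "1 - sA t u < 0" using p by (metis mult_less_0_iff order_less_asym)
    thus ?thesis using lt by simp
  qed
  have "extremal Ps35 (comb 1 (pA1 t u) (pA2 t u) (pA3 t u) (pA4 t u))"
    by (rule extremal_two_double_zeros[where t = t and s = "sA t u" and k = "kA t u"])
      (use n st t1 t Fp_eA[OF t(1) u(1)] in auto)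
  thus ?thesis unfolding eA_def using u by simp
qed

lemma extremal_eA_zero:
  assumes t: "0 \<le> t" "t \<le> 7"
  shows "extremal Ps35 (eA t 0)"
proof (cases "t = 1")
  case True
  \<comment> \<open>For t = 1 both double zeros collide at 1, where the argument by two double zeros
    fails; the form is already in family D.\<close>
  have "eA t 0 = scalef 36 (eD 1)" unfolding eA_def eD_def True scalef_comb by simp
  thus ?thesis using extremal_scalef[OF extremal_eD[of 1]] by simp
next
  case False
  define s where "s = (7-t)/(5*t+1)"
  have p: "5*t+1 > 0" using t by simp
  have s0: "s \<ge> 0" unfolding s_def using t by simp
  have sm: "s*(5*t+1) = 7-t" unfolding s_def using p by simp
  have s1: "s \<noteq> 1" using sm False by auto
  have "t \<noteq> s"
  proof
    assume "t = s"
    hence "t*(5*t+1) = 7-t" using sm by simp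
    hence "(t-1)*(5*t+7) = 0" by (simp add: algebra_simps)
    thus False using False t by auto
  qed
  note F = Fp_eA_zero[OF t(1), folded s_def]
  have F0: "Fp 0 ((5*t+1)^2) ((t-1)^2*(t^2 - 12*t - 1))
      (- 2*(t^4 + 36*t^3 + 34*t^2 + 60*t + 13)) (24*(t-1)^4) x \<ge> 0" for x
    unfolding F by simp
  have "nonneg_coeffs 0 ((5*t+1)^2) ((t-1)^2*(t^2 - 12*t - 1))
        (- 2*(t^4 + 36*t^3 + 34*t^2 + 60*t + 13)) (24*(t-1)^4)"
    unfolding nonneg_coeffs_def using F0 Qp_nonnegI[OF _ _ F0] by simp
  hence "extremal Ps35 (comb 0 ((5*t+1)^2) ((t-1)^2*(t^2 - 12*t - 1))
        (- 2*(t^4 + 36*t^3 + 34*t^2 + 60*t + 13)) (24*(t-1)^4))"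
    by (rule extremal_two_double_zeros[where t = t and s = s and k = "2*(5*t+1)^2"])
      (use F p s0 s1 \<open>t \<noteq> s\<close> False t in auto)
  thus ?thesis unfolding eA_def by simp
qed

section \<open>Family B: extremality\<close>

lemma Fp_difference_double_zero:
  assumes "Fp 0 0 0 c3 c4 t = 0" "Fp' 0 0 0 c3 c4 t = 0" "t > 0" "t \<noteq> 1"
  shows "c3 = 0 \<and> c4 = 0"
proof -
  have "Fp 0 0 0 c3 c4 t = t*(c3*(t-1)^2 + c4*(2*t+1))" unfolding Fp_def by algebra
  hence a: "c3*(t-1)^2 + c4*(2*t+1) = 0" using assms(1,3) by simp
  have "Fp' 0 0 0 c3 c4 t = c3*((t-1)^2+2*t*(t-1)) + c4*(4*t+1)" unfolding Fp'_def by algebra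
  hence b: "c3*((t-1)^2+2*t*(t-1)) + c4*(4*t+1) = 0" using assms(2) by simp
  have "(t-1) * (c4 * (2*t*(t+2))) = 0" using a b by algebra
  hence "c4 = 0" using assms(3,4) by simp
  thus ?thesis using a assms(4) by simp
qed

lemma Qp_eB: "Qp 1 (pB1 t v) (pB2 t v) w = (w-v)^2"
  unfolding Qp_def pB1_def pB2_def by algebra

lemma Fp'_eB:
  assumes "t > 0"
  shows "Fp' 1 (pB1 t v) (pB2 t v) (pB3 t v) (pB4 t v) t = 0"
  by (rule Fp'_zero_of_square_factor[where g = "GB t v", OF Fp_eB[OF assms]])
    (use assms in \<open>auto simp: GB_def[abs_def] intro!: derivative_eq_intros\<close>)

text \<open>A summand inherits the double zero v of Q, which makes d0, d1, d2 proportional to those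
  of the form. Subtracting d0 times the form leaves only s3 and s4, and no nonzero combination of
  these has a double zero at t.\<close>

lemma extremal_eB:
  assumes t: "t \<ge> 2" and u: "muB t \<le> u" "u \<le> 1"
  shows "extremal Ps35 (eB t u)"
proof -
  define v where "v = omega u"
  have v: "v \<ge> 0" "eps t v \<ge> 0"
    using omega_bounds[OF assms] eps_nonneg_iff[OF t] unfolding v_def by simp_all
  have t0: "t > 0" "t \<ge> 0" using t by simp_all
  note F = Fp_eB[OF t0(1)]
  have N: "nonneg_coeffs 1 (pB1 t v) (pB2 t v) (pB3 t v) (pB4 t v)"
    unfolding nonneg_coeffs_def F Qp_eB using GB_nonneg[OF t v] by simp
  have "extremal Ps35 (comb 1 (pB1 t v) (pB2 t v) (pB3 t v) (pB4 t v))"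
  proof (rule extremal_combI[OF N])
    fix d0 d1 d2 d3 d4
    assume d: "nonneg_coeffs d0 d1 d2 d3 d4"
      and dc: "\<And>x. x \<ge> 0 \<Longrightarrow> Fp d0 d1 d2 d3 d4 x \<le> Fp 1 (pB1 t v) (pB2 t v) (pB3 t v) (pB4 t v) x"
      and dq: "\<And>x. x \<ge> 0 \<Longrightarrow> Qp d0 d1 d2 x \<le> Qp 1 (pB1 t v) (pB2 t v) x"
    have z: "Fp 1 (pB1 t v) (pB2 t v) (pB3 t v) (pB4 t v) t = 0" unfolding F by simp
    note z' = Fp'_eB[OF t0(1), of v]
    have "3*d0+d1 = -2*d0*v \<and> d0+d1+d2 = d0*v^2"
    proof (rule dominated_square[OF v(1)])
      show "0 \<le> d0*x^2+(3*d0+d1)*x+(d0+d1+d2)" if "x > 0" for x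
        using d that unfolding nonneg_coeffs_def Qp_def by simp
      show "d0*x^2+(3*d0+d1)*x+(d0+d1+d2) \<le> 1*(x-v)^2" if "x > 0" for x
        using dq[of x] that unfolding Qp_eB unfolding Qp_def by simp
    qed
    hence d1: "d1 = d0*pB1 t v" and d2: "d2 = d0*pB2 t v" unfolding pB1_def pB2_def by algebra+
    define e3 e4 where "e3 = d3 - d0*pB3 t v" and "e4 = d4 - d0*pB4 t v"
    have E: "Fp 0 0 0 e3 e4 x = Fp d0 d1 d2 d3 d4 x - d0 * Fp 1 (pB1 t v) (pB2 t v) (pB3 t v) (pB4 t v) x"
      "Fp' 0 0 0 e3 e4 x = Fp' d0 d1 d2 d3 d4 x - d0 * Fp' 1 (pB1 t v) (pB2 t v) (pB3 t v) (pB4 t v) x" for x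
      unfolding Fp_linear(1,2)[symmetric] e3_def e4_def d1 d2 by simp_all
    have "e3 = 0 \<and> e4 = 0"
    proof (rule Fp_difference_double_zero)
      show "Fp 0 0 0 e3 e4 t = 0" "Fp' 0 0 0 e3 e4 t = 0"
        using dominated_Fp_double_zero[OF z z' t0(2) d dc] z z' by (simp_all add: E)
    qed (use t in auto)
    thus "\<exists>r. d0 = r*1 \<and> d1 = r*pB1 t v \<and> d2 = r*pB2 t v \<and> d3 = r*pB3 t v \<and> d4 = r*pB4 t v"
      using d1 d2 unfolding e3_def e4_def by (intro exI[of _ d0]) simp
  qed simp
  thus ?thesis unfolding eB_def v_def .
qed

lemma listed_extremal:
  assumes "g \<in> listed"
  shows "extremal Ps35 g"
proof -
  have A: "extremal Ps35 (eA t u)" if "0 \<le> t" "t \<le> 7" "0 \<le> u" "u \<le> muA t" for t u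
    using extremal_eA_pos extremal_eA_zero that by (cases "u = 0") auto
  show ?thesis
    using assms A extremal_eB extremal_eC extremal_eD extremal_eD_inf extremal_eE extremal_eE_inf extremal_s3
    unfolding listed_def by blast
qed

subsection \<open>Perturbing extremal forms\<close>

text \<open>Quadratic growth is the condition at infinity that lets a function absorb small
  multiples of x + x^2.\<close>

definition grows :: "(real \<Rightarrow> real) \<Rightarrow> bool" where
  "grows p \<longleftrightarrow> (\<exists>d>0. \<exists>N. \<forall>x\<ge>N. d * x^2 \<le> p x)"

lemma grows_quadratic:
  fixes a b c :: real
  assumes "a > 0"
  shows "grows (\<lambda>x. a*x^2 + b*x + c)"
proof -
  have "a/2 * x^2 \<le> a*x^2 + b*x + c" if x: "x \<ge> 1 + 2*(\<bar>b\<bar>+\<bar>c\<bar>)/a" for x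
  proof -
    have "2*(\<bar>b\<bar>+\<bar>c\<bar>)/a \<ge> 0" using assms by simp
    hence x1: "x \<ge> 1" "2*(\<bar>b\<bar>+\<bar>c\<bar>)/a \<le> x" using x by linarith+
    hence "2*(\<bar>b\<bar>+\<bar>c\<bar>) \<le> x*a" using assms by (simp add: divide_le_eq)
    hence "2*(\<bar>b\<bar>+\<bar>c\<bar>)*x \<le> x*a*x" using x1 by (intro mult_right_mono) auto
    moreover have "\<bar>c\<bar>*1 \<le> \<bar>c\<bar>*x" using x1 by (intro mult_left_mono) auto
    moreover have "- \<bar>b\<bar>*x \<le> b*x" using x1 by (intro mult_right_mono) auto
    moreover have "a/2*x^2 = x*a*x/2" "a*x^2 = x*a*x" by (simp_all add: power2_eq_square)
    moreover have "2*(\<bar>b\<bar>+\<bar>c\<bar>)*x = 2*(\<bar>b\<bar>*x) + 2*(\<bar>c\<bar>*x)" by (simp add: algebra_simps)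
    ultimately show ?thesis using abs_ge_minus_self[of c] by linarith
  qed
  moreover have "a/2 > 0" using assms by simp
  ultimately show ?thesis unfolding grows_def by blast
qed

lemma grows_Horner:
  fixes b :: real
  assumes "grows p"
  shows "grows (\<lambda>x. x * p x + b)"
proof -
  obtain d N where d: "d > 0" "\<And>x. x \<ge> N \<Longrightarrow> d * x^2 \<le> p x" using assms unfolding grows_def by blast
  have "d/2 * x^2 \<le> x * p x + b" if x: "x \<ge> max N (1 + 2*\<bar>b\<bar>/d)" for x
  proof -
    have "2*\<bar>b\<bar>/d \<ge> 0" using d by simp
    hence x1: "x \<ge> 1" "2*\<bar>b\<bar>/d \<le> x" "x \<ge> N" using x by auto
    hence "2*\<bar>b\<bar> \<le> d*x" using d by (simp add: divide_le_eq mult.commute)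
    moreover have "d*x*1 \<le> d*x*x" using x1 d by (intro mult_left_mono) auto
    ultimately have "\<bar>b\<bar> \<le> d/2*x^2" by (simp add: power2_eq_square algebra_simps)
    moreover have dx: "d*x^2 \<ge> 0" using d by simp
    moreover have "1*(d*x^2) \<le> x * p x" using x1 d(2)[of x] dx by (intro mult_mono) auto
    ultimately show ?thesis using abs_ge_minus_self[of b] by (simp add: algebra_simps)
  qed
  moreover have "d/2 > 0" using d by simp
  ultimately show ?thesis unfolding grows_def by blast
qed

lemma grows_cubic: "a > 0 \<Longrightarrow> grows (\<lambda>x::real. a*x^3 + b*x^2 + c*x + e)"
  using grows_Horner[OF grows_quadratic[of a b c], of e]
  by (simp add: power2_eq_square power3_eq_cube algebra_simps)

lemma grows_quartic: "a > 0 \<Longrightarrow> grows (\<lambda>x::real. a*x^4 + b*x^3 + c*x^2 + e*x + f)"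
  using grows_Horner[OF grows_cubic[of a b c e], of f]
  by (simp add: power2_eq_square power3_eq_cube power4_eq_xxxx algebra_simps)

lemma grows_quintic: "a > 0 \<Longrightarrow> grows (\<lambda>x::real. a*x^5 + b*x^4 + c*x^3 + e*x^2 + f*x + g)"
  using grows_Horner[OF grows_quartic[of a b c e f], of g]
  by (simp add: numeral_eq_Suc algebra_simps)

lemma grows_Fp:
  assumes "c0 > 0 \<or> c0 = 0 \<and> c1 > 0"
  shows "grows (Fp c0 c1 c2 c3 c4)"
proof -
  have F: "Fp c0 c1 c2 c3 c4 = (\<lambda>x. c0*x^5 + 2*c1*x^4 + (2*c2+c3)*x^3
      + (-2*c0-4*c1-2*c2-2*c3+2*c4)*x^2 + (-c0+c3+c4-2*c2)*x + 2*(c0+c1+c2))"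
    unfolding Fp_def[abs_def] by (rule ext) algebra
  show ?thesis using assms
  proof
    assume "c0 > 0" thus ?thesis unfolding F by (rule grows_quintic)
  next
    assume "c0 = 0 \<and> c1 > 0"
    thus ?thesis unfolding F using grows_quartic[of "2*c1" "2*c2+c3"] by simp
  qed
qed

lemma no_double_zero_grows:
  fixes f f' :: "real \<Rightarrow> real"
  assumes "\<And>x. (f has_real_derivative f' x) (at x)" "\<And>x. x \<ge> 0 \<Longrightarrow> f x \<ge> 0"
    and "\<not> (\<exists>x\<ge>0. f x = 0 \<and> f' x = 0)" and "grows f"
  obtains e where "e > 0" "\<And>x. x \<ge> 0 \<Longrightarrow> e * (x + x^2) \<le> f x"
  using no_double_zero_bound[OF assms(1,2)] assms(3,4) unfolding grows_def by metis

lemma extremal_nonneg_coeffs: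
  assumes "extremal Ps35 (comb c0 c1 c2 c3 c4)"
  shows "nonneg_coeffs c0 c1 c2 c3 c4"
  using assms comb_in_Ps35_iff unfolding extremal_def by blast

lemma extremal_has_double_zero:
  assumes ext: "extremal Ps35 (comb c0 c1 c2 c3 c4)" and c: "c0 > 0 \<or> c0 = 0 \<and> c1 > 0"
  shows "\<exists>t\<ge>0. Fp c0 c1 c2 c3 c4 t = 0 \<and> Fp' c0 c1 c2 c3 c4 t = 0"
proof (rule ccontr)
  assume no: "\<not> ?thesis"
  have N: "nonneg_coeffs c0 c1 c2 c3 c4" using extremal_nonneg_coeffs[OF ext] .
  have nn: "Fp c0 c1 c2 c3 c4 x \<ge> 0" if "x \<ge> 0" for x using N that unfolding nonneg_coeffs_def by blast
  obtain e where e: "e > 0" "\<And>x. x \<ge> 0 \<Longrightarrow> e * (x + x^2) \<le> Fp c0 c1 c2 c3 c4 x"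
    using no_double_zero_grows[OF DERIV_Fp nn no grows_Fp[OF c]] by blast
  have "nonneg_coeffs (c0-e/2*0) (c1-e/2*0) (c2-e/2*0) (c3-e/2*0) (c4-e/2*1)"
    unfolding nonneg_coeffs_def Fp_linear Fp_eE_inf
  proof (intro conjI allI impI)
    fix x :: real assume x: "x \<ge> 0"
    have "e/2*(x*(2*x+1)) \<le> e*(x+x^2)" using x e(1) by (simp add: power2_eq_square algebra_simps)
    thus "0 \<le> Fp c0 c1 c2 c3 c4 x - e/2*(x*(2*x+1))" using e(2)[OF x] by simp
    show "0 \<le> Qp c0 c1 c2 x - e/2 * Qp 0 0 0 x" using N x unfolding nonneg_coeffs_def by (simp add: Qp_def)
  qed
  from extremal_subtract_multiple[OF ext nonneg_coeffs_eE_inf _ this] e(1)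
  obtain r where "0 = r*c0" "0 = r*c1" "1 = r*c4" by auto
  thus False using c by auto
qed

lemma nonneg_cofactor:
  fixes p :: "real \<Rightarrow> real"
  assumes c: "\<And>x. isCont p x" and nn: "\<And>x. x \<ge> 0 \<Longrightarrow> (x-s)^2 * p x \<ge> 0" and x: "x \<ge> 0"
  shows "p x \<ge> 0"
proof (rule nonneg_off_point[OF c _ x])
  fix y assume "y > 0" "y \<noteq> s"
  thus "p y \<ge> 0" using nn[of y] by (simp add: zero_le_mult_iff)
qed

text \<open>With c4 = 0 the double zero at 1 is automatic and says nothing more. The argument is
  therefore repeated for the cofactor K of (x-1)^2, with s3 as direction, whose own cofactor is
  x.\<close>

lemma K_double_zero:
  assumes ext: "extremal Ps35 (comb c0 c1 c2 c3 0)" and c: "c0 > 0 \<or> c0 = 0 \<and> c1 > 0"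
  obtains s where "s \<ge> 0" "\<And>x. Fp c0 c1 c2 c3 0 x = (x-1)^2*((x-s)^2*(c0*x+(2*c0+2*c1+2*s*c0)))"
    "\<And>x. x \<ge> 0 \<Longrightarrow> c0*x+(2*c0+2*c1+2*s*c0) \<ge> 0"
proof -
  define k2 k1 k0 where "k2 = 2*c0+2*c1" and "k1 = 3*c0+4*c1+2*c2+c3" and "k0 = 2*(c0+c1+c2)"
  define K K' where "K x = c0*x^3+k2*x^2+k1*x+k0" and "K' x = 3*c0*x^2+2*k2*x+k1" for x
  have F: "Fp c0 c1 c2 c3 0 x = (x-1)^2 * K x" for x
    unfolding Fp_def K_def k2_def k1_def k0_def by algebra
  have N: "nonneg_coeffs c0 c1 c2 c3 0" using extremal_nonneg_coeffs[OF ext] .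
  have der: "(K has_real_derivative K' x) (at x)" for x
    unfolding K_def[abs_def] K'_def by (auto intro!: derivative_eq_intros)
  have nn: "K x \<ge> 0" if "x \<ge> 0" for x
  proof (rule nonneg_cofactor[OF _ _ that])
    show "isCont K x" for x using der DERIV_isCont by blast
    show "(x-1)^2 * K x \<ge> 0" if "x \<ge> 0" for x using N that unfolding nonneg_coeffs_def F by blast
  qed
  have gr: "grows K"
    using c
  proof
    assume "c0 > 0" thus ?thesis unfolding K_def[abs_def] by (rule grows_cubic)
  next
    assume "c0 = 0 \<and> c1 > 0"
    thus ?thesis using grows_quadratic[of k2 k1 k0] unfolding K_def[abs_def] k2_def by simp
  qed
  have "\<exists>s\<ge>0. K s = 0 \<and> K' s = 0"
  proof (rule ccontr)
    assume no: "\<not> ?thesis"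
    obtain e where e: "e > 0" "\<And>x. x \<ge> 0 \<Longrightarrow> e * (x + x^2) \<le> K x"
      using no_double_zero_grows[OF der nn no gr] by blast
    have "nonneg_coeffs (c0-e*0) (c1-e*0) (c2-e*0) (c3-e*1) (0-e*0)"
      unfolding nonneg_coeffs_def Fp_linear Fp_s3
    proof (intro conjI allI impI)
      fix x :: real assume x: "x \<ge> 0"
      have "e*x \<le> e*(x+x^2)" using x e(1) by simp
      hence "(x-1)^2*(e*x) \<le> (x-1)^2*K x" using e(2)[OF x] by (intro mult_left_mono) auto
      thus "0 \<le> Fp c0 c1 c2 c3 0 x - e*(x*(x-1)^2)" unfolding F by (simp add: mult_ac)
      show "0 \<le> Qp c0 c1 c2 x - e * Qp 0 0 0 x" using N x unfolding nonneg_coeffs_def by (simp add: Qp_def)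
    qed
    from extremal_subtract_multiple[OF ext nonneg_coeffs_s3 e(1) this]
    obtain r where "0 = r*c0" "0 = r*c1" "1 = r*c3" by auto
    thus False using c by auto
  qed
  then obtain s where s: "s \<ge> 0" "K s = 0" "K' s = 0" by blast
  have Ks: "K x = (x-s)^2*(c0*x+(2*c0+2*c1+2*s*c0))" for x
    using cubic_double_zero(1)[OF s(2)[unfolded K_def] s(3)[unfolded K'_def]] unfolding K_def k2_def by simp
  have "c0*x+(2*c0+2*c1+2*s*c0) \<ge> 0" if "x \<ge> 0" for x
    by (rule nonneg_cofactor[where s = s and p = "\<lambda>x. c0*x+(2*c0+2*c1+2*s*c0)"])
      (use nn that in \<open>auto simp: Ks\<close>)
  thus ?thesis using that s(1) F Ks by simp
qed

text \<open>The cofactor x(2x+m) of \<open>eE t\<close> is at most (2+|m|)(x+x^2) in absolute value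
  and its Q is w, so a small multiple can be both added and subtracted. The conclusion is absurd for
  c0 = 1 and identifies f with \<open>eE t\<close> for c0 = 0, c1 = 1.\<close>

lemma perturb_eE:
  assumes ext: "extremal Ps35 (comb c0 c1 c2 c3 c4)" and t: "t \<ge> 0"
    and F: "\<And>x. Fp c0 c1 c2 c3 c4 x = (x-t)^2 * G x"
    and e: "e > 0" "\<And>x. x \<ge> 0 \<Longrightarrow> e * (x + x^2) \<le> G x"
    and d: "d > 0" "\<And>w. w \<ge> 0 \<Longrightarrow> d * w \<le> Qp c0 c1 c2 w"
  shows "\<exists>r. 0 = r*c0 \<and> 1 = r*c1 \<and> -1 = r*c2 \<and> - (4*t^2 + 5*t + 3) / (t+2) = r*c3 \<and> (t-1)^3/(t+2) = r*c4"
proof -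
  define m where "m = (t-7)/(t+2)"
  note E = Fp_eE[OF t, folded m_def]
  define h where "h = min d (e/(2+\<bar>m\<bar>))"
  have m2: "2+\<bar>m\<bar> > 0" by simp
  have h: "h > 0" unfolding h_def using d(1) e(1) m2 by simp
  have hd: "h \<le> d" unfolding h_def by simp
  have "h \<le> e/(2+\<bar>m\<bar>)" unfolding h_def by (rule min.cobounded2)
  hence he: "h*(2+\<bar>m\<bar>) \<le> e" using m2 by (simp add: le_divide_eq)
  have G: "\<bar>h*(x*(2*x+m))\<bar> \<le> G x" if x: "x \<ge> 0" for x
  proof -
    have "\<bar>x*(2*x+m)\<bar> = x*\<bar>2*x+m\<bar>" using x by (simp add: abs_mult)
    also have "\<dots> \<le> x*(2*x+\<bar>m\<bar>)" using x by (intro mult_left_mono) auto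
    also have "\<dots> \<le> (2+\<bar>m\<bar>)*(x+x^2)"
    proof -
      have "(2+\<bar>m\<bar>)*(x+x^2) - x*(2*x+\<bar>m\<bar>) = 2*x + \<bar>m\<bar>*x^2" by algebra
      moreover have "2*x + \<bar>m\<bar>*x^2 \<ge> 0" using x by simp
      ultimately show ?thesis by linarith
    qed
    finally have "h*\<bar>x*(2*x+m)\<bar> \<le> h*((2+\<bar>m\<bar>)*(x+x^2))" using h by (intro mult_left_mono) auto
    also have "\<dots> = (h*(2+\<bar>m\<bar>))*(x+x^2)" by simp
    also have "\<dots> \<le> e*(x+x^2)" using he x by (intro mult_right_mono) auto
    also have "\<dots> \<le> G x" using e(2)[OF x] .
    finally show ?thesis using h by (simp add: abs_mult)
  qed
  have QE: "Qp 0 1 (-1) w = w" for w unfolding Qp_def by simp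
  have nn: "nonneg_coeffs (c0-k*0) (c1-k*1) (c2-k*(-1)) (c3-k*(- (4*t^2 + 5*t + 3) / (t+2))) (c4-k*((t-1)^3/(t+2)))"
    if k: "k = h \<or> k = -h" for k
    unfolding nonneg_coeffs_def Fp_linear E F QE
  proof (intro conjI allI impI)
    fix x :: real assume x: "x \<ge> 0"
    have "G x - k*(x*(2*x+m)) \<ge> 0" using G[OF x] k by auto
    hence "(x-t)^2*(G x - k*(x*(2*x+m))) \<ge> 0" by simp
    thus "0 \<le> (x-t)^2 * G x - k*((x-t)^2*(x*(2*x+m)))" by (simp add: algebra_simps)
    have "k*x \<le> h*x" using k h x by auto
    also have "\<dots> \<le> d*x" using hd x by (intro mult_right_mono) auto
    finally show "0 \<le> Qp c0 c1 c2 x - k*x" using d(2)[OF x] by simp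
  qed
  have "nonneg_coeffs (c0+h*0) (c1+h*1) (c2+h*(-1)) (c3+h*(- (4*t^2 + 5*t + 3) / (t+2))) (c4+h*((t-1)^3/(t+2)))"
    using nn[of "-h"] by simp
  from extremal_perturb[OF ext h nn[of h] this] show ?thesis by simp
qed

subsection \<open>Classification of the extremal forms\<close>

text \<open>Q = (w-v)^2 together with the double zero at t determines c3 and c4. Then c4 is a
  positive multiple of \<open>eps t v\<close>, so c4 \<ge> 0 yields both t \<ge> 2 and the upper
  bound on v.\<close>

lemma double_zero_above_one_listed:
  assumes v: "v \<ge> 0" and c1: "c1 = pB1 t v" and c2: "c2 = pB2 t v" and c4: "c4 \<ge> 0"
    and z: "Fp 1 c1 c2 c3 c4 t = 0" "Fp' 1 c1 c2 c3 c4 t = 0" and t: "t > 1"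
  shows "comb 1 c1 c2 c3 c4 \<in> listed"
proof -
  have t0: "t > 0" using t by simp
  define e3 e4 where "e3 = c3 - 1*pB3 t v" and "e4 = c4 - 1*pB4 t v"
  have E: "Fp 0 0 0 e3 e4 x = Fp 1 c1 c2 c3 c4 x - 1 * Fp 1 (pB1 t v) (pB2 t v) (pB3 t v) (pB4 t v) x"
    "Fp' 0 0 0 e3 e4 x = Fp' 1 c1 c2 c3 c4 x - 1 * Fp' 1 (pB1 t v) (pB2 t v) (pB3 t v) (pB4 t v) x" for x
    unfolding Fp_linear(1,2)[symmetric] e3_def e4_def c1 c2 by simp_all
  have "Fp 0 0 0 e3 e4 t = 0" "Fp' 0 0 0 e3 e4 t = 0"
    unfolding E z Fp_eB[OF t0] Fp'_eB[OF t0] by simp_all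
  hence "e3 = 0 \<and> e4 = 0" using Fp_difference_double_zero[of e3 e4 t] t0 t by simp
  hence c3: "c3 = pB3 t v" and c4': "c4 = pB4 t v" unfolding e3_def e4_def by simp_all
  have "pB4 t v = (t-1)^3/(t+2) * eps t v"
    unfolding pB4_def eps_def using t by (simp add: field_simps power2_eq_square)
  moreover have "(t-1)^3/(t+2) > 0" using t by simp
  ultimately have ep: "eps t v \<ge> 0" using c4 unfolding c4' by (metis zero_le_mult_iff not_less)
  have "v^2/t^2 \<ge> 0" by simp
  hence t2: "t \<ge> 2" using ep v unfolding eps_def by linarith
  have "v \<le> muR t - 2" using eps_nonneg_iff[OF t2 v] ep by simp
  then obtain u where u: "muB t \<le> u" "u \<le> 1" "omega u = v" using omega_surj[OF t2 v] by blast
  have "comb 1 c1 c2 c3 c4 = eB t u" unfolding eB_def u(3) c1 c2 c3 c4' ..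
  thus ?thesis unfolding listed_def using u t2 by blast
qed

text \<open>Excludes family B for t < 1. The cubic has a root -n \<le> 0 and a quadratic cofactor
  x^2 - g x + p; since g is positive and there is no double zero, p > g^2/4. The relation at 1 makes
  this too large, because the value of b2 forces g - 2 \<ge> n + 4 - 2t.\<close>

lemma double_zero_below_one_impossible:
  fixes b0 b1 b2 t v :: real
  assumes t: "0 \<le> t" "t < 1" and v: "v \<ge> 0" and b2: "b2 = 2*t - 6 - 4*v"
    and nn: "\<And>x. x \<ge> 0 \<Longrightarrow> x^3+b2*x^2+b1*x+b0 \<ge> 0"
    and no: "\<And>x. x \<ge> 0 \<Longrightarrow> x^3+b2*x^2+b1*x+b0 = 0 \<Longrightarrow> 3*x^2+2*b2*x+b1 \<noteq> 0"
    and rel: "3*(1-t)*(3+2*b2+b1) + (1+5*t)*(1+b2+b1+b0) = 0"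
  shows False
proof -
  define G where "G x = x^3+b2*x^2+b1*x+b0" for x
  have b0: "b0 \<ge> 0" using nn[of 0] by simp
  have "\<exists>n\<ge>0. G (-n) = 0"
  proof -
    \<comment> \<open>Large enough for the cubic term to make G(-M) \<le> 0; the term with b2 is
      nonpositive anyway.\<close>
    define M where "M = 1 + \<bar>b1\<bar> + b0"
    have M: "M \<ge> 1" unfolding M_def using b0 by simp
    have "G (-M) = - (M*M*M) + b2*(M*M) - b1*M + b0" unfolding G_def by (simp add: power2_eq_square power3_eq_cube)
    moreover have "b2*(M*M) \<le> 0" using b2 t v by (intro mult_nonpos_nonneg) auto
    moreover have "M*M*1 \<le> M*M*M" using M by (intro mult_left_mono) auto
    moreover have "M*M = M + \<bar>b1\<bar>*M + b0*M" unfolding M_def by (simp add: algebra_simps)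
    moreover have "b0*1 \<le> b0*M" using M b0 by (intro mult_left_mono) auto
    moreover have "- b1*M \<le> \<bar>b1\<bar>*M" using M by (intro mult_right_mono) auto
    ultimately have "G (-M) \<le> 0" using M by linarith
    moreover have "G 0 \<ge> 0" unfolding G_def using b0 by simp
    moreover have "isCont G x" for x unfolding G_def[abs_def] by simp
    ultimately obtain y where "- M \<le> y" "y \<le> 0" "G y = 0" using IVT[of G "-M" 0 0] M by auto
    thus ?thesis by (intro exI[of _ "-y"]) simp
  qed
  then obtain n where n: "n \<ge> 0" "G (-n) = 0" by blast
  define g p where "g = n - b2" and "p = b1 + n*g"
  have np: "b0 = n*p" using n(2) unfolding G_def p_def g_def by algebra
  have Gf: "G x = (x+n)*(x^2-g*x+p)" for x unfolding G_def np p_def g_def by algebra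
  have g4: "g - 2 \<ge> n + 4 - 2*t" "g > 4" unfolding g_def b2 using n t v by auto
  have "p > g^2/4"
  proof -
    have "G (g/2) \<ge> 0" unfolding G_def using nn[of "g/2"] g4 by simp
    moreover have "G (g/2) = (g/2+n)*(p - g^2/4)" unfolding Gf by (simp add: power2_eq_square field_simps)
    moreover have "g/2+n > 0" using g4 n by simp
    ultimately have "p \<ge> g^2/4" by (simp add: zero_le_mult_iff)
    moreover have "p \<noteq> g^2/4"
    proof
      assume p: "p = g^2/4"
      have z: "(g/2)^3+b2*(g/2)^2+b1*(g/2)+b0 = 0"
        using Gf[of "g/2"] unfolding G_def p by (simp add: power2_eq_square)
      have b: "b2 = n - g" "b1 = p - n*g" unfolding p_def g_def by simp_all
      have "3*(g/2)^2+2*b2*(g/2)+b1 = 0"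
        unfolding b p by (simp add: power2_eq_square field_simps)
      thus False using no[of "g/2"] z g4 by simp
    qed
    ultimately show ?thesis by simp
  qed
  define P where "P = 1 - g + p"
  have P: "P > (g-2)^2/4" unfolding P_def using \<open>p > g^2/4\<close> by (simp add: power2_eq_square field_simps)
  have b: "b2 = n - g" "b1 = p - n*g" unfolding p_def g_def by simp_all
  \<comment> \<open>The relation at 1, with G(1) = (1+n)P and G'(1) = P - (1+n)(g-2).\<close>
  have key: "3*(1-t)*(1+n)*(g-2) = P*(3*(1-t)+(1+5*t)*(1+n))"
    using rel unfolding np P_def b by algebra
  have pos: "3*(1-t)+(1+5*t)*(1+n) > 0" using t n by (intro add_pos_nonneg) auto
  have "(g-2)^2/4*(3*(1-t)+(1+5*t)*(1+n)) < 3*(1-t)*(1+n)*(g-2)"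
    unfolding key using P pos by (intro mult_strict_right_mono) auto
  hence "(g-2)*((g-2)*(3*(1-t)+(1+5*t)*(1+n))) < (g-2)*(12*(1-t)*(1+n))"
    by (simp add: power2_eq_square field_simps)
  hence "(g-2)*(3*(1-t)+(1+5*t)*(1+n)) < 12*(1-t)*(1+n)"
    using g4 mult_less_cancel_left_pos[of "g-2"] by simp
  moreover have "(n+4-2*t)*(3*(1-t)+(1+5*t)*(1+n)) \<le> (g-2)*(3*(1-t)+(1+5*t)*(1+n))"
    using g4 pos by (intro mult_right_mono) auto
  moreover have "(n+4-2*t)*(3*(1-t)+(1+5*t)*(1+n)) - 12*(1-t)*(1+n) =
      (n-2)^2 + 5*t*n^2 + t*(12-4*t) + t*n*(32-10*t)" by algebra
  moreover have "5*t*n^2 \<ge> 0" "t*(12-4*t) \<ge> 0" "t*n*(32-10*t) \<ge> 0" using t n by simp_all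
  ultimately show False using zero_le_power2[of "n-2"] by linarith
qed

lemma two_double_zeros_listed:
  assumes F: "\<And>x. Fp 1 c1 c2 c3 c4 x = (x-t)^2*(x-s)^2*(x+k)"
    and rel: "6*(1-s)*(1+k) + 6*(1-t)*(1+k) + 3*(1-t)*(1-s) = 5*(1-t)*(1-s)*(1+k)"
    and ts: "t \<ge> 0" "s \<ge> 0" "k \<ge> 0" "t \<noteq> 1"
  shows "comb 1 c1 c2 c3 c4 \<in> listed"
proof -
  \<comment> \<open>Solves s = \<open>sA t u\<close> for u. The relation then takes the form
    \<open>key\<close>, which yields u > 0 and k = \<open>kA t u\<close>, while s \<ge> 0 and k
    \<ge> 0 become the two bounds in \<open>muA\<close>.\<close>
  define u where "u = (t+2)*(7-t) - s*((t+2)*(5*t+1))"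
  have key: "u*(k*(5*t+1)+2*(t+2)) = 18*(t+2)*(t-1)^2"
    using rel unfolding u_def by algebra
  have "k*(5*t+1)+2*(t+2) > 0" "18*(t+2)*(t-1)^2 > 0" using ts by (auto intro!: add_nonneg_pos)
  hence u: "u > 0" using key by (metis zero_less_mult_iff order_less_asym)
  have uH: "u \<le> (t+2)*(7-t)" unfolding u_def using ts by simp
  hence "(t+2)*(7-t) > 0" using u by linarith
  hence t7: "t \<le> 7" using ts by (simp add: zero_less_mult_iff)
  have "2*(t+2)*(9*(t-1)^2 - u) = k*((5*t+1)*u)" using key by algebra
  moreover have "(5*t+1)*u \<noteq> 0" using ts u by simp
  ultimately have k: "k = kA t u" unfolding kA_def by (metis nonzero_eq_divide_eq)
  have "k*((5*t+1)*u) \<ge> 0" using ts u by simp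
  hence "2*(t+2)*(9*(t-1)^2 - u) \<ge> 0" using \<open>2*(t+2)*(9*(t-1)^2 - u) = k*((5*t+1)*u)\<close> by simp
  hence uL: "u \<le> 9*(t-1)^2" using ts by (simp add: zero_le_mult_iff)
  have "s * ((t+2)*(5*t+1)) = (t+2)*(7-t) - u" unfolding u_def by simp
  moreover have "(t+2)*(5*t+1) \<noteq> 0" using ts by simp
  ultimately have s: "s = sA t u" unfolding sA_def by (metis nonzero_eq_divide_eq)
  have "Fp 1 c1 c2 c3 c4 x = 1 * Fp 1 (pA1 t u) (pA2 t u) (pA3 t u) (pA4 t u) x" for x
    unfolding F Fp_eA[OF ts(1) u] s k by simp
  from Fp_eq_coeffs[OF this] have "c1 = pA1 t u \<and> c2 = pA2 t u \<and> c3 = pA3 t u \<and> c4 = pA4 t u" by simp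
  hence "comb 1 c1 c2 c3 c4 = eA t u" unfolding eA_def using u by simp
  moreover have "u \<le> muA t" unfolding muA_def muL_def muH_def using uL uH by simp
  ultimately show ?thesis unfolding listed_def using ts(1) t7 u by fastforce
qed

text \<open>Equality in the second bound means Q = (w - sqrt q)^2, as in family B. Strict inequality
  gives Q a lower bound d w with d > 0, which is room for a perturbation.\<close>

lemma Qp_dichotomy:
  assumes "\<And>w. w \<ge> 0 \<Longrightarrow> Qp 1 c1 c2 w \<ge> 0"
  defines "q \<equiv> 1 + c1 + c2"
  shows "q \<ge> 0" "3 + c1 \<ge> - 2 * sqrt q"
proof -
  show q: "q \<ge> 0" using assms(1)[of 0] unfolding Qp_def q_def by simp
  show "3 + c1 \<ge> - 2 * sqrt q"
  proof (rule ccontr)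
    assume "\<not> ?thesis"
    hence l: "2 * sqrt q < - (3+c1)" by simp
    have sq: "sqrt q \<ge> 0" using q by simp
    have "(2 * sqrt q)^2 < (- (3+c1))^2" using l sq by (intro power_strict_mono) auto
    hence "4*q < (3+c1)^2" unfolding power2_minus using q by (simp add: power_mult_distrib)
    moreover have "Qp 1 c1 c2 (-(3+c1)/2) = q - (3+c1)^2/4"
      unfolding Qp_def q_def by (simp add: power2_eq_square field_simps)
    moreover have "-(3+c1) \<ge> 0" using l sq by linarith
    hence "-(3+c1)/2 \<ge> 0" by simp
    ultimately show False using assms(1)[of "-(3+c1)/2"] by simp
  qed
qed

text \<open>\<open>eD s\<close> has Q(w) = w + s^2, so this is the criterion of
  \<open>Qp_dichotomy\<close> in the converse direction, after removing e times
  \<open>eD s\<close>.\<close>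

lemma eD_subtract_Qp:
  assumes "q - e*s^2 \<ge> 0" "b - e \<ge> - 2 * sqrt (q - e*s^2)" "w \<ge> 0"
  shows "w^2 + b*w + q - e*(w+s^2) \<ge> (0::real)"
proof -
  define y where "y = sqrt (q - e*s^2)"
  have y2: "y^2 = q - e*s^2" unfolding y_def using assms(1) by simp
  have "(b-e)*w \<ge> (-2*y)*w" using assms(2,3) unfolding y_def by (intro mult_right_mono) auto
  moreover have "(w-y)^2 = w^2 + (-2*y)*w + (q - e*s^2)" unfolding y2[symmetric] by algebra
  moreover have "w^2 + b*w + q - e*(w+s^2) = w^2 + (b-e)*w + (q - e*s^2)" by algebra
  ultimately show ?thesis using zero_le_power2[of "w-y"] by linarith
qed

text \<open>Here f = \<open>eC s\<close> + (k/2) \<open>eD s\<close>. If k = 0, f is in family C. If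
  k > 0, \<open>eC s\<close> must lie outside the cone, so s > 2, and no small multiple of
  \<open>eD s\<close> may be removed, so Q is a square and f is in family B.\<close>

lemma extremal_monic_vanishing_at_one:
  assumes ext: "extremal Ps35 (comb 1 c1 c2 c3 0)"
  shows "comb 1 c1 c2 c3 0 \<in> listed"
proof -
  have N: "nonneg_coeffs 1 c1 c2 c3 0" using extremal_nonneg_coeffs[OF ext] .
  obtain s where s: "s \<ge> 0"
    and F1: "\<And>x. Fp 1 c1 c2 c3 0 x = (x-1)^2*((x-s)^2*(1*x+(2*1+2*c1+2*s*1)))"
    and k1: "\<And>x. x \<ge> 0 \<Longrightarrow> 1*x+(2*1+2*c1+2*s*1) \<ge> 0"
    using K_double_zero[OF ext] by (metis zero_less_one)
  define k where "k = 2+2*c1+2*s"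
  have F: "Fp 1 c1 c2 c3 0 x = (x-1)^2*(x-s)^2*(x+k)" for x
    unfolding F1 k_def by simp
  have k: "k \<ge> 0" using k1[of 0] unfolding k_def by simp
  define q where "q = 1 + c1 + c2"
  have Q: "Qp 1 c1 c2 w = w^2 + (3+c1)*w + q" for w unfolding Qp_def q_def by simp
  have nnQ: "Qp 1 c1 c2 w \<ge> 0" if "w \<ge> 0" for w using N that unfolding nonneg_coeffs_def by blast
  note dich = Qp_dichotomy[OF nnQ, folded q_def]
  have q2: "2*q = s^2*k" using F[of 0] unfolding Fp_zero q_def by simp
  have c1: "c1 = - (s+1) + k/2" unfolding k_def by (simp add: field_simps)
  have "Fp (1-k/2*0) (c1-k/2*1) (c2-k/2*(s^2-1)) (c3-k/2*(-2*(s+1)^2)) (0-k/2*0) x =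
     1 * Fp 1 (-(s+1)) s ((s+1)^2) 0 x" for x
    unfolding Fp_linear F Fp_eD Fp_eC by (simp add: algebra_simps)
  from Fp_eq_coeffs[OF this]
  have c2: "c2-k/2*(s^2-1) = s" and c3: "c3-k/2*(-2*(s+1)^2) = (s+1)^2" by simp_all
  have notD: False if e: "e > 0" "nonneg_coeffs (1-e*0) (c1-e*1) (c2-e*(s^2-1)) (c3-e*(-2*(s+1)^2)) (0-e*0)" for e
  proof -
    obtain r where "0 = r*1" "1 = r*c1"
      using extremal_subtract_multiple[OF ext nonneg_coeffs_eD e] by blast
    thus False by simp
  qed
  show ?thesis
  proof (cases "k = 0")
    case True
    have "s \<le> 2" using dich(2) q2 c1 True by simp
    moreover have "comb 1 c1 c2 c3 0 = eC s" using c1 c2 c3 True unfolding eC_def by simp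
    ultimately show ?thesis unfolding listed_def using s by blast
  next
    case False
    hence kpos: "k > 0" using k by simp
    have s2: "s > 2"
    proof (rule ccontr)
      assume "\<not> s > 2"
      hence "nonneg_coeffs 1 (-(s+1)) s ((s+1)^2) 0" using nonneg_coeffs_eC s by simp
      moreover have "c1-k/2*1 = -(s+1)" using c1 by simp
      ultimately show False using notD[of "k/2"] kpos c2 c3 by simp
    qed
    have qpos: "q > 0" using q2 kpos s2 by (metis mult_pos_pos zero_less_mult_pos zero_less_numeral zero_less_power less_trans)
    have "3 + c1 = - 2 * sqrt q"
    proof (rule ccontr)
      assume "3 + c1 \<noteq> - 2 * sqrt q"
      hence d: "3 + c1 + 2 * sqrt q > 0" using dich(2) by simp
      \<comment> \<open>Strictness of the bound on the linear coefficient of Q survives the removal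
        of e times \<open>eD s\<close> for small e, by continuity.\<close>
      have "((\<lambda>e. 3 + c1 - e + 2 * sqrt (q - e*s^2)) \<longlongrightarrow> 3 + c1 - 0 + 2 * sqrt (q - 0*s^2)) (at_right 0)"
        by (intro tendsto_intros)
      hence "\<forall>\<^sub>F e in at_right 0. 3 + c1 - e + 2 * sqrt (q - e*s^2) > 0"
        using order_tendstoD(1) d by fastforce
      then obtain h where h: "h > 0" "\<And>e. 0 < e \<Longrightarrow> e < h \<Longrightarrow> 3 + c1 - e + 2 * sqrt (q - e*s^2) > 0"
        unfolding eventually_at_right_field by auto
      \<comment> \<open>The bound h/2 protects Q; the bound k/2 keeps the linear factor x + k - 2e
        of F nonnegative.\<close>
      define e where "e = min (h/2) (k/2)"
      have e: "e > 0" "e < h" "e \<le> k/2" unfolding e_def using h kpos by auto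
      have "e*s^2 \<le> k/2*s^2" using e(3) by (intro mult_right_mono) auto
      hence qe: "q - e*s^2 \<ge> 0" using q2 by (simp add: mult.commute)
      have be: "3 + c1 - e \<ge> - 2 * sqrt (q - e*s^2)" using h(2)[OF e(1,2)] by simp
      have QD: "Qp 0 1 (s^2-1) w = w + s^2" for w unfolding Qp_def by simp
      have "nonneg_coeffs (1-e*0) (c1-e*1) (c2-e*(s^2-1)) (c3-e*(-2*(s+1)^2)) (0-e*0)"
        unfolding nonneg_coeffs_def Fp_linear F Fp_eD Q QD
      proof (intro conjI allI impI)
        fix x :: real assume x: "x \<ge> 0"
        have "(x-1)^2*(x-s)^2*(x+(k-2*e)) \<ge> 0" using x e(3) by simp
        thus "0 \<le> (x-1)^2*(x-s)^2*(x+k) - e*(2*(x-1)^2*(x-s)^2)" by (simp add: algebra_simps)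
        show "0 \<le> x^2 + (3+c1)*x + q - e*(x+s^2)" using eD_subtract_Qp[OF qe be x] .
      qed
      thus False using notD e(1) by blast
    qed
    hence c1v: "c1 = pB1 s (sqrt q)" and c2v: "c2 = pB2 s (sqrt q)"
      unfolding pB1_def pB2_def using qpos q_def by simp_all
    have "Fp' 1 c1 c2 c3 0 s = 0"
      by (rule Fp'_zero_of_square_factor[where g = "\<lambda>x. (x-1)^2*(x+k)"])
        (auto simp: F intro!: derivative_eq_intros)
    moreover have "Fp 1 c1 c2 c3 0 s = 0" unfolding F by simp
    ultimately show ?thesis
      using double_zero_above_one_listed[OF _ c1v c2v] qpos s2 by simp
  qed
qed

lemma extremal_monic_listed:
  assumes ext: "extremal Ps35 (comb 1 c1 c2 c3 c4)"
  shows "comb 1 c1 c2 c3 c4 \<in> listed"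
proof (cases "c4 = 0")
  case True thus ?thesis using extremal_monic_vanishing_at_one ext by simp
next
  case c4: False
  have N: "nonneg_coeffs 1 c1 c2 c3 c4" using extremal_nonneg_coeffs[OF ext] .
  have nnF: "Fp 1 c1 c2 c3 c4 x \<ge> 0" if "x \<ge> 0" for x using N that unfolding nonneg_coeffs_def by blast
  have nnQ: "Qp 1 c1 c2 w \<ge> 0" if "w \<ge> 0" for w using N that unfolding nonneg_coeffs_def by blast
  have c4pos: "c4 > 0" using nnF[of 1] c4 unfolding Fp_one by simp
  obtain t where t: "t \<ge> 0" and z: "Fp 1 c1 c2 c3 c4 t = 0" "Fp' 1 c1 c2 c3 c4 t = 0"
    using extremal_has_double_zero[OF ext] by auto
  have t1: "t \<noteq> 1" using z(1) c4 Fp_one by auto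
  obtain b2 b1 b0 where
    F1: "\<And>x. Fp 1 c1 c2 c3 c4 x = (x-t)^2*(1*x^3+b2*x^2+b1*x+b0)"
    and b2: "b2 = 2*c1 + 2*t*1"
    and rel1: "t \<noteq> 1 \<Longrightarrow> 3*(1-t)*(3*1+2*b2+b1) + (1+5*t)*(1+b2+b1+b0) = 0"
    using Fp_double_zero_factor[OF z] by metis
  define G G' where "G x = x^3+b2*x^2+b1*x+b0" and "G' x = 3*x^2+2*b2*x+b1" for x
  have F: "Fp 1 c1 c2 c3 c4 x = (x-t)^2*G x" for x unfolding F1 G_def by simp
  have rel: "3*(1-t)*(3+2*b2+b1) + (1+5*t)*(1+b2+b1+b0) = 0" using rel1[OF t1] by simp
  have der: "(G has_real_derivative G' x) (at x)" for x
    unfolding G_def[abs_def] G'_def by (auto intro!: derivative_eq_intros)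
  have nnG: "G x \<ge> 0" if "x \<ge> 0" for x
  proof (rule nonneg_cofactor[OF _ _ that])
    show "isCont G x" for x using der DERIV_isCont by blast
    show "(x-t)^2 * G x \<ge> 0" if "x \<ge> 0" for x using nnF[OF that] unfolding F .
  qed
  have gr: "grows G" unfolding G_def[abs_def] using grows_cubic[of 1] by simp
  show ?thesis
  proof (cases "\<exists>s\<ge>0. G s = 0 \<and> G' s = 0")
    case True
    then obtain s where s: "s \<ge> 0" "G s = 0" "G' s = 0" by blast
    define k where "k = b2+2*s"
    have g: "1*s^3+b2*s^2+b1*s+b0 = 0" "3*1*s^2+2*b2*s+b1 = 0" using s unfolding G_def G'_def by simp_all
    have Gk: "G x = (x-s)^2*(x+k)" for x
      using cubic_double_zero(1)[OF g, of x] unfolding G_def k_def by simp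
    have s1: "s \<noteq> 1" using c4 F[of 1] Fp_one[of 1 c1 c2 c3 c4] unfolding Gk by auto
    have G1: "3+2*b2+b1 = 2*(1-s)*(1+k) + (1-s)^2" "1+b2+b1+b0 = (1-s)^2*(1+k)"
      using cubic_double_zero[OF g, of 1] unfolding k_def by simp_all
    have "(1-s)*(6*(1-s)*(1+k) + 6*(1-t)*(1+k) + 3*(1-t)*(1-s) - 5*(1-t)*(1-s)*(1+k)) = 0"
      using rel unfolding G1 by algebra
    hence R: "6*(1-s)*(1+k) + 6*(1-t)*(1+k) + 3*(1-t)*(1-s) = 5*(1-t)*(1-s)*(1+k)" using s1 by simp
    have "0 + k \<ge> 0"
      by (rule nonneg_cofactor[where s = s and p = "\<lambda>x. x+k"]) (use nnG in \<open>auto simp: Gk\<close>)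
    thus ?thesis using two_double_zeros_listed[OF _ R t s(1) _ t1] F Gk by (simp add: mult.assoc)
  next
    case no: False
    define q where "q = 1 + c1 + c2"
    note dich = Qp_dichotomy[OF nnQ, folded q_def]
    show ?thesis
    proof (cases "3 + c1 = - 2 * sqrt q")
      case True
      have v: "sqrt q \<ge> 0" using dich(1) by simp
      have c1v: "c1 = pB1 t (sqrt q)" and c2v: "c2 = pB2 t (sqrt q)"
        unfolding pB1_def pB2_def using dich(1) True q_def by simp_all
      have "\<not> t < 1"
      proof
        assume "t < 1"
        moreover have "b2 = 2*t - 6 - 4*sqrt q" using b2 True by simp
        ultimately show False
          using double_zero_below_one_impossible[OF t _ v _ _ _ rel] nnG no
          unfolding G_def G'_def by blast
      qed
      thus ?thesis using double_zero_above_one_listed[OF v c1v c2v _ z] c4pos t1 by simp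
    next
      case False
      hence d: "3 + c1 + 2 * sqrt q > 0" using dich(2) by simp
      have Q: "(3 + c1 + 2 * sqrt q) * w \<le> Qp 1 c1 c2 w" for w
      proof -
        have "Qp 1 c1 c2 w - (3 + c1 + 2 * sqrt q) * w = w^2 - 2 * sqrt q * w + (sqrt q)^2"
          unfolding Qp_def using dich(1) q_def by (simp add: algebra_simps)
        also have "\<dots> = (w - sqrt q)^2" by algebra
        finally show ?thesis using zero_le_power2[of "w - sqrt q"] by linarith
      qed
      obtain e where e: "e > 0" "\<And>x. x \<ge> 0 \<Longrightarrow> e * (x + x^2) \<le> G x"
        using no_double_zero_grows[OF der nnG no gr] by blast
      \<comment> \<open>Contradiction: 0 = r*1 gives r = 0, against 1 = r*c1.\<close>
      obtain r where "0 = r*1" "1 = r*c1" using perturb_eE[OF ext t F e d Q] by blast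
      thus ?thesis by simp
    qed
  qed
qed

lemma extremal_quartic_listed:
  assumes ext: "extremal Ps35 (comb 0 1 c2 c3 c4)"
  shows "\<exists>g \<in> listed. \<exists>r>0. comb 0 1 c2 c3 c4 = scalef r g"
proof -
  have N: "nonneg_coeffs 0 1 c2 c3 c4" using extremal_nonneg_coeffs[OF ext] .
  have nnF: "Fp 0 1 c2 c3 c4 x \<ge> 0" if "x \<ge> 0" for x using N that unfolding nonneg_coeffs_def by blast
  have listedI: "\<exists>g \<in> listed. \<exists>r>0. f = scalef r g" if "f \<in> listed" for f
    using that by (intro bexI[of _ f] exI[of _ 1]) (auto simp: scalef_def)
  show ?thesis
  proof (cases "c4 = 0")
    case True
    obtain s where s: "s \<ge> 0"
      and F1: "\<And>x. Fp 0 1 c2 c3 0 x = (x-1)^2*((x-s)^2*(0*x+(2*0+2*1+2*s*0)))"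
      using K_double_zero[of 0 1 c2 c3] ext True by (metis zero_less_one)
    have "Fp 0 1 c2 c3 0 x = 1 * Fp 0 1 (s^2-1) (-2*(s+1)^2) 0 x" for x
      unfolding F1 Fp_eD by simp
    from Fp_eq_coeffs[OF this] have "comb 0 1 c2 c3 c4 = eD s" unfolding eD_def True by simp
    hence "comb 0 1 c2 c3 c4 \<in> listed" unfolding listed_def using s by blast
    thus ?thesis by (rule listedI)
  next
    case c4: False
    obtain t where t: "t \<ge> 0" and z: "Fp 0 1 c2 c3 c4 t = 0" "Fp' 0 1 c2 c3 c4 t = 0"
      using extremal_has_double_zero[OF ext] by auto
    have t1: "t \<noteq> 1" using z(1) c4 Fp_one by auto
    obtain b2 b1 b0 where
      F1: "\<And>x. Fp 0 1 c2 c3 c4 x = (x-t)^2*(0*x^3+b2*x^2+b1*x+b0)"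
      and b2: "b2 = 2*1 + 2*t*0"
      and rel1: "t \<noteq> 1 \<Longrightarrow> 3*(1-t)*(3*0+2*b2+b1) + (1+5*t)*(0+b2+b1+b0) = 0"
      using Fp_double_zero_factor[OF z] by metis
    define G G' where "G x = 2*x^2+b1*x+b0" and "G' x = 4*x+b1" for x
    have F: "Fp 0 1 c2 c3 c4 x = (x-t)^2*G x" for x unfolding F1 G_def b2 by simp
    have rel: "3*(1-t)*(4+b1) + (1+5*t)*(2+b1+b0) = 0" using rel1[OF t1] b2 by simp
    have der: "(G has_real_derivative G' x) (at x)" for x
      unfolding G_def[abs_def] G'_def by (auto intro!: derivative_eq_intros)
    have nnG: "G x \<ge> 0" if "x \<ge> 0" for x
    proof (rule nonneg_cofactor[OF _ _ that])
      show "isCont G x" for x using der DERIV_isCont by blast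
      show "(x-t)^2 * G x \<ge> 0" if "x \<ge> 0" for x using nnF[OF that] unfolding F .
    qed
    have gr: "grows G" unfolding G_def[abs_def] using grows_quadratic[of 2] by simp
    show ?thesis
    proof (cases "\<exists>s\<ge>0. G s = 0 \<and> G' s = 0")
      case True
      then obtain s where s: "s \<ge> 0" "G s = 0" "G' s = 0" by blast
      have b1: "b1 = -4*s" using s(3) unfolding G'_def by simp
      have b0: "b0 = 2*s^2" using s(2) unfolding G_def b1 by (simp add: power2_eq_square)
      have Gs: "G x = 2*(x-s)^2" for x unfolding G_def b1 b0 by algebra
      have s1: "s \<noteq> 1" using c4 F[of 1] Fp_one[of 0 1 c2 c3 c4] unfolding Gs by auto
      have "(1-s)*(7-t-s*(5*t+1)) = 0" using rel unfolding b1 b0 by algebra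
      hence st: "s*(5*t+1) = 7-t" using s1 by simp
      have p: "5*t+1 > 0" using t by simp
      hence s': "s = (7-t)/(5*t+1)" using st by (simp add: field_simps)
      have "s*(5*t+1) \<ge> 0" using s(1) p by simp
      hence t7: "t \<le> 7" unfolding st by simp
      \<comment> \<open>\<open>eA t 0\<close> has s1-coefficient (5t+1)^2, whereas here it is
        normalised to 1.\<close>
      define c where "c = 1/(5*t+1)^2"
      have c: "c > 0" "c*(2*(5*t+1)^2) = 2" unfolding c_def using p by auto
      have "Fp 0 1 c2 c3 c4 x = c * Fp 0 ((5*t+1)^2) ((t-1)^2*(t^2 - 12*t - 1))
          (- 2*(t^4 + 36*t^3 + 34*t^2 + 60*t + 13)) (24*(t-1)^4) x" for x
      proof -
        have "(x-t)^2*(2*(x-s)^2) = (x-t)^2*((c*(2*(5*t+1)^2))*(x-s)^2)" unfolding c(2) ..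
        thus ?thesis unfolding F Gs Fp_eA_zero[OF t] s'[symmetric] by (simp only: mult_ac)
      qed
      from Fp_eq_coeffs[OF this] have "comb 0 1 c2 c3 c4 = scalef c (eA t 0)"
        unfolding eA_def if_P[OF refl] scalef_comb by (simp only: mult_zero_right)
      moreover have "0 \<le> muA t" unfolding muA_def muL_def muH_def using t t7 by simp
      hence "eA t 0 \<in> listed" unfolding listed_def using t t7 by fastforce
      ultimately show ?thesis using c(1) by blast
    next
      case no: False
      have Q: "1 * w \<le> Qp 0 1 c2 w" for w
      proof -
        have "Qp 0 1 c2 0 \<ge> 0" using N unfolding nonneg_coeffs_def by simp
        thus ?thesis unfolding Qp_def by simp
      qed
      obtain e where e: "e > 0" "\<And>x. x \<ge> 0 \<Longrightarrow> e * (x + x^2) \<le> G x"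
        using no_double_zero_grows[OF der nnG no gr] by blast
      have "comb 0 1 c2 c3 c4 = eE t"
        using perturb_eE[OF ext t F e zero_less_one Q] unfolding eE_def by auto
      moreover have "t \<ge> 7"
      proof -
        have c: "c2 = -1 \<and> c3 = - (4*t^2 + 5*t + 3) / (t+2) \<and> c4 = (t-1)^3/(t+2)"
          using perturb_eE[OF ext t F e zero_less_one Q] by auto
        have nn: "(x-t)^2*(x*(2*x+(t-7)/(t+2))) \<ge> 0" if "x \<ge> 0" for x
          using nnF[OF that] Fp_eE[OF t, of x] c by simp
        \<comment> \<open>The linear factor of F is nonnegative at every x > 0 other than t, and by
          continuity at 0, where this says t \<ge> 7.\<close>
        have "2*0+(t-7)/(t+2) \<ge> 0"
        proof (rule nonneg_off_point[where s = t and p = "\<lambda>x. 2*x+(t-7)/(t+2)"])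
          fix x :: real assume x: "x > 0" "x \<noteq> t"
          have "(x-t)^2*x > 0" using x by simp
          moreover have "((x-t)^2*x)*(2*x+(t-7)/(t+2)) \<ge> 0" using nn[of x] x by (simp add: mult.assoc)
          ultimately show "2*x+(t-7)/(t+2) \<ge> 0" by (metis zero_le_mult_iff not_less)
        qed (use t in \<open>auto intro!: continuous_intros\<close>)
        thus ?thesis using t by (simp add: zero_le_divide_iff)
      qed
      ultimately have "comb 0 1 c2 c3 c4 \<in> listed" unfolding listed_def by blast
      thus ?thesis by (rule listedI)
    qed
  qed
qed

text \<open>With c0 = c1 = 0 the form is c2 times \<open>eD_inf\<close> plus (2 c2 + c3) times s3
  plus c4 times \<open>eE_inf\<close>, with nonnegative coefficients; so one summand is all of
  it.\<close>

lemma extremal_cubic_listed: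
  assumes ext: "extremal Ps35 (comb 0 0 c2 c3 c4)"
  shows "\<exists>g \<in> listed. \<exists>r>0. comb 0 0 c2 c3 c4 = scalef r g"
proof -
  have N: "nonneg_coeffs 0 0 c2 c3 c4" using extremal_nonneg_coeffs[OF ext] .
  have nz: "\<not> (c2 = 0 \<and> c3 = 0 \<and> c4 = 0)" using ext comb_eq_zero unfolding extremal_def by blast
  have c2: "c2 \<ge> 0" using N unfolding nonneg_coeffs_def Qp_def by auto
  have nnF: "Fp 0 0 c2 c3 c4 x \<ge> 0" if "x \<ge> 0" for x using N that unfolding nonneg_coeffs_def by blast
  have c4: "c4 \<ge> 0" using nnF[of 1] unfolding Fp_one by simp
  have c3: "2*c2 + c3 \<ge> 0"
  proof (rule ccontr)
    assume "\<not> ?thesis"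
    hence neg: "-(2*c2+c3) > 0" by simp
    \<comment> \<open>This polynomial is -F - 1; the constant is lowered by 1 so that nonnegativity
      at a single large x already contradicts F \<ge> 0.\<close>
    have "grows (\<lambda>x. -(2*c2+c3)*x^3 + (2*c2+2*c3-2*c4)*x^2 + (2*c2-c3-c4)*x + (-2*c2-1))"
      using grows_cubic[OF neg] .
    then obtain d N where d: "d > 0" "\<And>x. x \<ge> N \<Longrightarrow>
        d*x^2 \<le> -(2*c2+c3)*x^3 + (2*c2+2*c3-2*c4)*x^2 + (2*c2-c3-c4)*x + (-2*c2-1)"
      unfolding grows_def by blast
    define x where "x = max N 0"
    have "Fp 0 0 c2 c3 c4 x =
       - (-(2*c2+c3)*x^3 + (2*c2+2*c3-2*c4)*x^2 + (2*c2-c3-c4)*x + (-2*c2-1)) - 1"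
      unfolding Fp_def by algebra
    moreover have "d*x^2 \<ge> 0" using d(1) by simp
    moreover have "x \<ge> N" "x \<ge> 0" unfolding x_def by auto
    ultimately show False using nnF[of x] d(2)[of x] by linarith
  qed
  have L: "eD_inf \<in> listed" "s3 \<in> listed" "eE_inf \<in> listed" unfolding listed_def by auto
  consider "c2 > 0" | "c2 = 0" "c3 > 0" | "c2 = 0" "c3 = 0" "c4 > 0" using nz c2 c3 c4 by fastforce
  thus ?thesis
  proof cases
    case 1
    have "nonneg_coeffs (0-c2*0) (0-c2*0) (c2-c2*1) (c3-c2*(-2)) (c4-c2*0)"
    proof -
      have F: "Fp 0 0 0 (2*c2+c3) c4 x = (2*c2+c3)*(x*(x-1)^2) + c4*(x*(2*x+1))" for x unfolding Fp_def by algebra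
      have "nonneg_coeffs 0 0 0 (2*c2+c3) c4" unfolding nonneg_coeffs_def F using c3 c4 by (simp add: Qp_def)
      thus ?thesis by (simp add: algebra_simps)
    qed
    from extremal_subtract_multiple[OF ext nonneg_coeffs_eD_inf 1 this]
    obtain r where r: "1 = r*c2" "-2 = r*c3" "0 = r*c4" by blast
    hence "c3 = c2*(-2)" "c4 = 0" by algebra+
    hence "comb 0 0 c2 c3 c4 = scalef c2 eD_inf" unfolding eD_inf_def scalef_comb by simp
    thus ?thesis using L 1 by blast
  next
    case 2
    have "nonneg_coeffs (0-c3*0) (0-c3*0) (c2-c3*0) (c3-c3*1) (c4-c3*0)"
    proof -
      have F: "Fp 0 0 0 0 c4 x = c4*(x*(2*x+1))" for x unfolding Fp_def by algebra
      have "nonneg_coeffs 0 0 0 0 c4" unfolding nonneg_coeffs_def F using c4 by (simp add: Qp_def)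
      thus ?thesis using 2 by simp
    qed
    from extremal_subtract_multiple[OF ext nonneg_coeffs_s3 2(2) this]
    obtain r where r: "1 = r*c3" "0 = r*c4" by blast
    hence "c4 = 0" by algebra
    hence "comb 0 0 c2 c3 c4 = scalef c3 s3" unfolding s3_comb scalef_comb using 2 by simp
    thus ?thesis using L 2 by blast
  next
    case 3
    hence "comb 0 0 c2 c3 c4 = scalef c4 eE_inf" unfolding eE_inf_def scalef_comb by simp
    thus ?thesis using L 3 by blast
  qed
qed

lemma scalef_inverse:
  assumes "a > 0" "scalef (1/a) f = scalef r g"
  shows "f = scalef (a*r) g"
proof -
  have "f x y z = a * r * g x y z" for x y z
    using fun_cong[OF fun_cong[OF fun_cong[OF assms(2)]], of x y z] assms(1)
    by (simp add: scalef_def field_simps)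
  thus ?thesis unfolding scalef_def by blast
qed

lemma extremal_listed:
  assumes ext: "extremal Ps35 f"
  shows "\<exists>g \<in> listed. \<exists>r>0. f = scalef r g"
proof -
  have "f \<in> Ps35" using ext unfolding extremal_def by blast
  then obtain c0 c1 c2 c3 c4 where f: "f = comb c0 c1 c2 c3 c4" and N: "nonneg_coeffs c0 c1 c2 c3 c4"
    by (rule in_Ps35_E)
  have c0: "c0 \<ge> 0" using N Qp_nonneg_leading unfolding nonneg_coeffs_def by blast
  have rescale: "\<exists>g \<in> listed. \<exists>r>0. f = scalef r g"
    if "a > 0" "\<exists>g \<in> listed. \<exists>r>0. scalef (1/a) f = scalef r g" for a
    using that scalef_inverse by (metis mult_pos_pos)
  have E: "extremal Ps35 (scalef (1/a) f)" if "a > 0" for a using extremal_scalef[OF ext] that by simp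
  consider "c0 > 0" | "c0 = 0" "c1 \<noteq> 0" | "c0 = 0" "c1 = 0" using c0 by force
  thus ?thesis
  proof cases
    case 1
    have g: "scalef (1/c0) f \<in> listed"
      using E[OF 1] extremal_monic_listed 1 unfolding f scalef_comb by simp
    have "f = scalef c0 (scalef (1/c0) f)" using 1 by (simp add: scalef_def)
    thus ?thesis using g 1 by blast
  next
    case 2
    have "c1*w + (c1+c2) \<ge> 0" if "w \<ge> 0" for w
      using N that 2 unfolding nonneg_coeffs_def Qp_def by simp
    hence pos: "w*(c1*w + (c1+c2)) \<ge> 0" if "w \<ge> 0" for w using that by simp
    \<comment> \<open>Multiplying the linear Q by w gives a quadratic with leading coefficient c1,
      to which \<open>Qp_nonneg_leading\<close> applies.\<close>
    have "Qp c1 (c2-2*c1) (c1-c2) w = w*(c1*w + (c1+c2))" for w unfolding Qp_def by algebra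
    hence "Qp c1 (c2-2*c1) (c1-c2) w \<ge> 0" if "w \<ge> 0" for w using pos[OF that] by simp
    hence "c1 \<ge> 0" by (rule Qp_nonneg_leading)
    hence c1: "c1 > 0" using 2(2) by simp
    have "scalef (1/c1) f = comb 0 1 (1/c1*c2) (1/c1*c3) (1/c1*c4)"
      using 2 unfolding f scalef_comb by simp
    thus ?thesis using rescale[OF c1] E[OF c1] extremal_quartic_listed by metis
  next
    case 3
    hence "f = comb 0 0 c2 c3 c4" unfolding f by simp
    thus ?thesis using extremal_cubic_listed ext by blast
  qed
qed

theorem theorem1p4:
  shows "(\<forall>g \<in> listed. extremal Ps35 g) \<and>
         (\<forall>f. extremal Ps35 f \<longrightarrow> (\<exists>g \<in> listed. \<exists>r > 0. f = scalef r g))"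
  using listed_extremal extremal_listed by blast

end
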